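(* Let $\theta\in\mathbb{R}$ and $a>b>0$. Let $H^{\theta,a}$ (resp. $H^{\theta,b}$) be a Brownian motion with drift $-2\theta$ reflected in $[0,a]$ (resp. in $[0,b]$) and started at $0$. Then the process $\pi_{a,b}(H^{\theta,a})$ is distributed as $H^{\theta,b}$.
   Context: For $\theta\in\mathbb{R}$ and $c>0$, the Brownian motion $H^{\theta,c}$ with drift $-2\theta$ reflected in $[0,c]$ and started at $0$ is the unique $[0,c]$-valued continuous solution of $dY_t=d\beta_t-2\theta\,dt+\frac12dL_0(t)-\frac12dL_c(t)$, $Y_0=0$, where $\beta$ is a standard Brownian motion and $L_r(t)$ is the local time of $Y$ at level $r$ up to time $t$, normalized as the occupation density with respect to Lebesgue measure, continuous in $(r,t)\in[0,c]\times\mathbb{R}_+$. For $c>0$ let $\mathcal{C}^c$ be the set of continuous functions from $\mathbb{R}_+$ to $[0,c]$. For $a>b>0$ and $\varphi\in\mathcal{C}^a$, set $A_t=\int_0^t\mathbf 1_{\{\varphi(s)\le b\}}ds$ and $C_\varphi(t)=\inf\{r\ge0:A_r>t\}$, with the conventions $\inf\emptyset=\infty$ and $\varphi(\infty)=b$. The projection $\pi_{a,b}:\mathcal{C}^a\to\mathcal{C}^b$ is $\pi_{a,b}(\varphi)=\varphi\circ C_\varphi$. *)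

theory Defs
  imports "HOL-Probability.Probability"
begin

text \<open>
  Time runs over \<open>{0..}\<close>; paths and processes are functions on the type of reals of which only
  the values at nonnegative times matter.
\<close>

definition standard_brownian_motion :: "'w measure \<Rightarrow> (real \<Rightarrow> 'w \<Rightarrow> real) \<Rightarrow> bool" where
  "standard_brownian_motion M \<beta> \<longleftrightarrow>
     prob_space M \<and>
     (\<forall>t\<ge>0. \<beta> t \<in> borel_measurable M) \<and>
     (AE \<omega> in M. \<beta> 0 \<omega> = 0) \<and>
     (AE \<omega> in M. continuous_on {0..} (\<lambda>t. \<beta> t \<omega>)) \<and>
     (\<forall>s t. 0 \<le> s \<and> s < t \<longrightarrow>
        distributed M lborel (\<lambda>\<omega>. \<beta> t \<omega> - \<beta> s \<omega>)
          (\<lambda>x. ennreal (normal_density 0 (sqrt (t - s)) x))) \<and>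
     (\<forall>(n::nat) \<tau>. 0 \<le> \<tau> 0 \<and> mono \<tau> \<longrightarrow>
        prob_space.indep_vars M (\<lambda>_. borel)
          (\<lambda>i \<omega>. \<beta> (\<tau> (Suc i)) \<omega> - \<beta> (\<tau> i) \<omega>) {..<n})"

definition cont_paths :: "real \<Rightarrow> (real \<Rightarrow> real) set" where
  "cont_paths c = {\<phi>. continuous_on {0..} \<phi> \<and> (\<forall>t\<ge>0. \<phi> t \<in> {0..c})}"

text \<open>
  \<open>L r t\<close> is the local time at level \<open>r\<close> up to time \<open>t\<close>.  Joint continuity and the occupation
  density formula determine \<open>L\<close> on \<open>{0..c} \<times> {0..}\<close>, including at the boundary levels, and
  force it to be nonnegative there.
\<close>

definition is_local_time :: "real \<Rightarrow> (real \<Rightarrow> real) \<Rightarrow> (real \<Rightarrow> real \<Rightarrow> real) \<Rightarrow> bool" where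
  "is_local_time c \<phi> L \<longleftrightarrow>
     continuous_on ({0..c} \<times> {0..}) (\<lambda>(r, t). L r t) \<and>
     (\<forall>t\<ge>0. \<forall>B\<in>sets borel. B \<subseteq> {0..c} \<longrightarrow>
        measure lborel {s \<in> {0..t}. \<phi> s \<in> B} = (LINT r:B|lborel. L r t))"

text \<open>
  The last clause is the integrated form of
  \<open>dY\<^sub>t = d\<beta>\<^sub>t - 2\<theta> dt + (1/2) dL\<^sub>0(t) - (1/2) dL\<^sub>c(t)\<close> with \<open>Y\<^sub>0 = 0\<close>.
  No filtration is needed: the local time at a level grows only while \<open>Y\<close> is at that level, so
  the equation is a two-sided Skorokhod reflection problem, which determines \<open>Y\<close> pathwise
  from \<open>\<beta>\<close>.
\<close>

definition reflected_brownian_motion ::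
    "real \<Rightarrow> real \<Rightarrow> 'w measure \<Rightarrow> (real \<Rightarrow> 'w \<Rightarrow> real) \<Rightarrow> bool" where
  "reflected_brownian_motion \<theta> c M Y \<longleftrightarrow>
     prob_space M \<and>
     (\<forall>t\<ge>0. Y t \<in> borel_measurable M) \<and>
     (\<forall>\<omega>\<in>space M. (\<lambda>t. Y t \<omega>) \<in> cont_paths c) \<and>
     (AE \<omega> in M. Y 0 \<omega> = 0) \<and>
     (\<exists>\<beta>. standard_brownian_motion M \<beta> \<and>
        (AE \<omega> in M. \<exists>L. is_local_time c (\<lambda>t. Y t \<omega>) L \<and>
           (\<forall>t\<ge>0. Y t \<omega> = \<beta> t \<omega> - 2 * \<theta> * t + 1/2 * L 0 t - 1/2 * L c t)))"

definition time_below :: "real \<Rightarrow> (real \<Rightarrow> real) \<Rightarrow> real \<Rightarrow> real" where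
  "time_below b \<phi> t = (LINT s:{0..t}|lborel. indicator {s. \<phi> s \<le> b} s)"

text \<open>In \<^typ>\<open>ereal\<close> the infimum of the empty set is \<open>\<infinity>\<close>.\<close>

definition inv_time_below :: "real \<Rightarrow> (real \<Rightarrow> real) \<Rightarrow> real \<Rightarrow> ereal" where
  "inv_time_below b \<phi> t = Inf (ereal ` {r. 0 \<le> r \<and> time_below b \<phi> r > t})"

text \<open>
  The projection from \<open>cont_paths a\<close> to \<open>cont_paths b\<close>; its formula involves \<open>a\<close> only through
  the domain.  The case distinction implements the convention \<open>\<phi>(\<infinity>) = b\<close>.  A path whose
  total time below \<open>b\<close> is finite but which keeps making ever shorter excursions below \<open>b\<close> can
  have a discontinuous image; almost sure continuity of the image is therefore stated separately.
\<close>

definition path_proj :: "real \<Rightarrow> (real \<Rightarrow> real) \<Rightarrow> real \<Rightarrow> real" where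
  "path_proj b \<phi> t =
     (case inv_time_below b \<phi> t of ereal r \<Rightarrow> \<phi> r | _ \<Rightarrow> b)"

text \<open>
  Equality in law of processes.  The Borel sigma-algebra of locally uniform convergence on
  continuous paths is the trace of the product sigma-algebra used here.  Measurability is
  demanded explicitly because \<^const>\<open>distr\<close> is meaningless without it.
\<close>

definition path_space :: "(real \<Rightarrow> real) measure" where
  "path_space = (\<Pi>\<^sub>M t\<in>{0..}. borel)"

definition path_map :: "(real \<Rightarrow> 'w \<Rightarrow> real) \<Rightarrow> 'w \<Rightarrow> real \<Rightarrow> real" where
  "path_map X \<omega> = (\<lambda>t\<in>{0..}. X t \<omega>)"

definition same_law ::
    "'v measure \<Rightarrow> (real \<Rightarrow> 'v \<Rightarrow> real) \<Rightarrow> 'w measure \<Rightarrow> (real \<Rightarrow> 'w \<Rightarrow> real) \<Rightarrow> bool" where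
  "same_law M X N Y \<longleftrightarrow>
     path_map X \<in> measurable M path_space \<and>
     path_map Y \<in> measurable N path_space \<and>
     distr M path_space (path_map X) = distr N path_space (path_map Y)"

end

theory Submission
  imports Defs
begin

text \<open>
  Let \<open>W\<close> be the driving Brownian motion with drift, sampled at mesh \<open>1/n\<close>.  Adding its
  increments and clipping to \<open>{0..a}\<close> after each step gives a walk that is uniformly close to
  \<open>H\<^sup>\<theta>\<^sup>,\<^sup>a\<close>.  Keep only the increments used while this walk is at most \<open>b\<close>.  Whether an increment
  is kept is decided by the earlier ones, so the kept increments are again i.i.d. with the same law,
  and the walk in \<open>{0..b}\<close> that they drive is close to the censored walk: clipping is nonexpansive,
  and an excursion above \<open>b\<close> ends within one step of \<open>b\<close>.  Since \<open>H\<^sup>\<theta>\<^sup>,\<^sup>a\<close> spends no time at level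
  \<open>b\<close>, the discrete clocks converge, and in the limit the kept walk becomes
  \<open>\<pi>\<^sub>a\<^sub>,\<^sub>b(H\<^sup>\<theta>\<^sup>,\<^sup>a)\<close>, while in law it is a discretisation of \<open>H\<^sup>\<theta>\<^sup>,\<^sup>b\<close>.

  The time spent below \<open>b\<close> is almost surely infinite: otherwise infinitely many passages from \<open>0\<close> to
  \<open>b\<close> would be squeezed into an arbitrarily short time of the kept walk, against the continuity
  of \<open>H\<^sup>\<theta>\<^sup>,\<^sup>b\<close>.
\<close>

section \<open>Reflected and censored walks\<close>

text \<open>Gluing together the noise run below \<open>b\<close> in continuous time calls for
  stopping times and a filtration, whereas the driving motion is given by independent increments
  along deterministic times. At a fixed mesh the gluing becomes an exact identity of laws of i.i.d.
  sequences, proved by peeling off one increment at a time. What remains is pathwise: each discrete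
  walk converges on its own space by deterministic estimates, and equality in law passes to almost
  sure limits at fixed times without coupling the two spaces.

  The delicate point of the limit is the time change. An excursion above \<open>b\<close> collapses
  to one instant of the clock, so the times at which the kept walk is read need not converge. Their
  limit points still carry one and the same path value, because the path is at least
  \<open>b\<close> wherever the clock stands still.

  Unboundedness of the clock has to come before the limit is identified. It is therefore obtained by
  comparing, at each mesh, the probabilities of an oscillation event of the kept walk and of the
  walk in \<open>{0..b}\<close>.\<close>

definition clip :: "real \<Rightarrow> real \<Rightarrow> real" where
  "clip c y = max 0 (min c y)"

lemma clip_nonexpansive: "\<bar>clip c y - clip c z\<bar> \<le> \<bar>y - z\<bar>"
  unfolding clip_def by (simp add: min_def max_def)

lemma borel_measurable_clip [measurable]:
  assumes [measurable]: "f \<in> borel_measurable M"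
  shows "(\<lambda>x. clip c (f x)) \<in> borel_measurable M"
  unfolding clip_def by simp

fun reflected_walk :: "real \<Rightarrow> real \<Rightarrow> (nat \<Rightarrow> real) \<Rightarrow> nat \<Rightarrow> real" where
  "reflected_walk c r x 0 = r"
| "reflected_walk c r x (Suc k) = clip c (reflected_walk c r x k + x k)"

text \<open>
  \<open>censor a b K r x\<close> lists the increments \<open>x k\<close> used while the walk from \<open>r\<close> is at most \<open>b\<close>.
  From the horizon \<open>K\<close> on every increment is kept, so that the list is infinite for every \<open>x\<close>.
\<close>

fun censor :: "real \<Rightarrow> real \<Rightarrow> nat \<Rightarrow> real \<Rightarrow> (nat \<Rightarrow> real) \<Rightarrow> nat \<Rightarrow> real" where
  "censor a b 0 r x = x"
| "censor a b (Suc K) r x =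
     (if r \<le> b
      then case_nat (x 0) (censor a b K (clip a (r + x 0)) (\<lambda>k. x (Suc k)))
      else censor a b K (clip a (r + x 0)) (\<lambda>k. x (Suc k)))"

text \<open>Only indices strictly before \<open>k\<close> are counted, so the value is the slot that
  \<open>x k\<close> receives in the censored list if it is kept. Rescaled by the mesh it is the
  discrete form of \<open>time_below\<close>.\<close>

definition visits :: "real \<Rightarrow> real \<Rightarrow> real \<Rightarrow> (nat \<Rightarrow> real) \<Rightarrow> nat \<Rightarrow> nat" where
  "visits a b r x k = card {i. i < k \<and> reflected_walk a r x i \<le> b}"

lemma visits_0 [simp]: "visits a b r x 0 = 0"
  by (simp add: visits_def)

lemma visits_Suc:
  "visits a b r x (Suc k) = visits a b r x k + (if reflected_walk a r x k \<le> b then 1 else 0)"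
proof -
  have "{i. i < Suc k \<and> reflected_walk a r x i \<le> b} =
      {i. i < k \<and> reflected_walk a r x i \<le> b} \<union> (if reflected_walk a r x k \<le> b then {k} else {})"
    by (auto simp: less_Suc_eq)
  then show ?thesis by (simp add: visits_def)
qed

text \<open>\<open>censor\<close> recurses from the front, the walk from the back. Peeling off the
  first step and restarting at \<open>clip c (r + x 0)\<close> reconciles the two.\<close>

lemma reflected_walk_shift:
  "reflected_walk c r x (Suc k) = reflected_walk c (clip c (r + x 0)) (\<lambda>k. x (Suc k)) k"
  by (induction k) auto

lemma visits_shift:
  "visits a b r x (Suc k) =
     (if r \<le> b then 1 else 0) + visits a b (clip a (r + x 0)) (\<lambda>k. x (Suc k)) k"
proof (induction k)
  case 0
  show ?case by (simp add: visits_Suc)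
next
  case (Suc k)
  then show ?case
    unfolding visits_Suc[of a b r x "Suc k"] visits_Suc[of a b "clip a (r + x 0)" _ k]
      reflected_walk_shift by simp
qed

lemma visits_mono: "j \<le> k \<Longrightarrow> visits a b r x j \<le> visits a b r x k"
  unfolding visits_def by (rule card_mono) auto

text \<open>A kept increment is filed behind exactly those kept before it, and \<open>visits\<close>
  counts these. The bound \<open>k < K\<close> places the decision before the horizon.\<close>

lemma censor_visits:
  "k < K \<Longrightarrow> reflected_walk a r x k \<le> b \<Longrightarrow> censor a b K r x (visits a b r x k) = x k"
proof (induction K arbitrary: k r x)
  case (Suc K)
  show ?case
  proof (cases k)
    case 0
    with Suc.prems show ?thesis by simp
  next
    case (Suc j)
    with Suc.prems have "reflected_walk a (clip a (r + x 0)) (\<lambda>k. x (Suc k)) j \<le> b"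
      by (simp only: reflected_walk_shift)
    with Suc.IH[of j "clip a (r + x 0)" "\<lambda>k. x (Suc k)"] Suc.prems Suc
    show ?thesis by (simp add: visits_shift)
  qed
qed simp

text \<open>The invariant has two regimes. At most \<open>b\<close>, both walks receive the same
  increment and clipping is nonexpansive; above \<open>b\<close>, the kept walk is frozen within
  \<open>d\<close> of \<open>b\<close>, and the return undershoots \<open>b\<close> by at most
  \<open>d\<close>. Hence the error stays at \<open>d\<close> through any number of
  excursions.\<close>

lemma censored_walk_close:
  assumes "0 < b" "b < a" "0 \<le> d"
    and step: "\<And>i. i < k \<Longrightarrow> \<bar>reflected_walk a 0 x (Suc i) - reflected_walk a 0 x i\<bar> \<le> d"
    and "k \<le> K"
  defines "R \<equiv> reflected_walk b 0 (censor a b K 0 x)"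
  shows "if reflected_walk a 0 x k \<le> b
      then \<bar>reflected_walk a 0 x k - R (visits a b 0 x k)\<bar> \<le> d
      else b - d \<le> R (visits a b 0 x k)"
  using step \<open>k \<le> K\<close>
proof (induction k)
  case 0
  show ?case using \<open>0 < b\<close> \<open>0 \<le> d\<close> by (simp add: R_def)
next
  case (Suc k)
  define X where "X = reflected_walk a 0 x"
  define N where "N = visits a b 0 x k"
  have R_le: "R j \<le> b" for j
    using \<open>0 < b\<close> by (cases j) (auto simp: R_def clip_def)
  have IH: "if X k \<le> b then \<bar>X k - R N\<bar> \<le> d else b - d \<le> R N"
    using Suc unfolding X_def N_def by simp
  have XS: "X (Suc k) = clip a (X k + x k)" by (simp add: X_def)
  have dX: "\<bar>X (Suc k) - X k\<bar> \<le> d" using Suc.prems(1)[of k] by (simp add: X_def)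
  show ?case
  proof (cases "X k \<le> b")
    case True
    then have N': "visits a b 0 x (Suc k) = Suc N"
      unfolding X_def N_def by (simp add: visits_Suc)
    have "censor a b K 0 x N = x k"
      unfolding N_def by (rule censor_visits) (use True Suc.prems in \<open>auto simp: X_def\<close>)
    then have RS: "R (Suc N) = clip b (R N + x k)" by (simp add: R_def)
    have near: "\<bar>clip b (X k + x k) - R (Suc N)\<bar> \<le> d"
      using clip_nonexpansive[of b "X k + x k" "R N + x k"] IH True unfolding RS by simp
    \<comment> \<open>A step ending at most \<open>b\<close> is clipped alike in
      \<open>{0..a}\<close> and in \<open>{0..b}\<close>; a step that crosses \<open>b\<close> is
      clipped to \<open>b\<close> itself.\<close>
    have "X (Suc k) \<le> b \<Longrightarrow> clip b (X k + x k) = X (Suc k)"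
      and "\<not> X (Suc k) \<le> b \<Longrightarrow> clip b (X k + x k) = b"
      using assms(1,2) unfolding XS clip_def by (auto simp: min_def max_def split: if_splits)
    with near show ?thesis unfolding N' X_def by auto
  next
    case False
    then have N': "visits a b 0 x (Suc k) = N"
      unfolding X_def N_def by (simp add: visits_Suc)
    \<comment> \<open>On re-entry both values lie in \<open>{b - d..b}\<close>.\<close>
    have "X (Suc k) \<le> b \<Longrightarrow> \<bar>X (Suc k) - R N\<bar> \<le> d"
      using IH False dX R_le[of N] by auto
    then show ?thesis using IH False unfolding N' X_def by auto
  qed
qed

text \<open>
  A discrete maximum principle: the two boundary terms can only push the two paths together once
  they are more than \<open>d\<close> apart.
\<close>

lemma reflected_walk_close:
  assumes "0 \<le> c" "0 \<le> d" and p: "\<And>k. k \<le> m \<Longrightarrow> p k \<in> {0..c}" and "p 0 = 0"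
    and step: "\<And>k. k < m \<Longrightarrow> p (Suc k) = p k + x k + l k - u k"
    and l: "\<And>k. k < m \<Longrightarrow> 0 \<le> l k" "\<And>k. k < m \<Longrightarrow> 0 < l k \<Longrightarrow> p (Suc k) \<le> d"
    and u: "\<And>k. k < m \<Longrightarrow> 0 \<le> u k" "\<And>k. k < m \<Longrightarrow> 0 < u k \<Longrightarrow> c - d \<le> p (Suc k)"
    and "k \<le> m"
  shows "\<bar>reflected_walk c 0 x k - p k\<bar> \<le> d"
  using \<open>k \<le> m\<close>
proof (induction k)
  case 0
  show ?case using \<open>p 0 = 0\<close> \<open>0 \<le> d\<close> by simp
next
  case (Suc k)
  define X where "X = reflected_walk c 0 x"
  have IH: "\<bar>X k - p k\<bar> \<le> d" using Suc by (simp add: X_def)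
  have XS: "X (Suc k) = clip c (X k + x k)" by (simp add: X_def)
  have pk: "p (Suc k) \<in> {0..c}" using p Suc.prems by simp
  have k: "k < m" using Suc.prems by simp
  note s = step[OF k] l(1)[OF k] l(2)[OF k] u(1)[OF k] u(2)[OF k]
  have "\<bar>X (Suc k) - p (Suc k)\<bar> \<le> d"
  proof (cases "p (Suc k) + d < X (Suc k)")
    case True
    \<comment> \<open>The walk exceeds \<open>p\<close> by more than \<open>d\<close>: it is
      positive, so clipping did not raise it, and \<open>u k > 0\<close> would put it above
      \<open>c\<close>. The gap has not grown, which contradicts the induction hypothesis. The other
      case is the mirror image.\<close>
    then have "X (Suc k) \<le> X k + x k" "u k = 0"
      using pk s \<open>0 \<le> c\<close> \<open>0 \<le> d\<close> unfolding XS clip_def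
      by (fastforce simp: min_def max_def split: if_splits)+
    then show ?thesis using IH True s by auto
  next
    case False
    show ?thesis
    proof (cases "X (Suc k) + d < p (Suc k)")
      case True
      then have "X k + x k \<le> X (Suc k)" "l k = 0"
        using pk s \<open>0 \<le> c\<close> \<open>0 \<le> d\<close> unfolding XS clip_def
        by (fastforce simp: min_def max_def split: if_splits)+
      then show ?thesis using IH True s by auto
    qed (use False in auto)
  qed
  then show ?case by (simp add: X_def)
qed

section \<open>Measurability and law of the kept increments\<close>

lemma measurable_reflected_walk [measurable]:
  "(\<lambda>x. reflected_walk c r x k) \<in> borel_measurable (\<Pi>\<^sub>M i\<in>UNIV. borel)"
  by (induction k) simp_all

text \<open>Start and sequence both depend on \<open>w\<close>, because the recursive call changes
  both.\<close>

lemma measurable_censor_nth: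
  assumes "\<rho> \<in> borel_measurable M" "\<And>i. (\<lambda>w. X w i) \<in> borel_measurable M"
  shows "(\<lambda>w. censor a b K (\<rho> w) (X w) j) \<in> borel_measurable M"
  using assms
proof (induction K arbitrary: \<rho> X j)
  case (Suc K)
  note [measurable] = Suc.prems
  have [measurable]:
    "(\<lambda>w. censor a b K (clip a (\<rho> w + X w 0)) (\<lambda>k. X w (Suc k)) j) \<in> borel_measurable M" for j
    by (rule Suc.IH) measurable
  have "censor a b (Suc K) r x j =
      (if r \<le> b then case j of 0 \<Rightarrow> x 0 | Suc i \<Rightarrow> censor a b K (clip a (r + x 0)) (\<lambda>k. x (Suc k)) i
       else censor a b K (clip a (r + x 0)) (\<lambda>k. x (Suc k)) j)" for r x
    by (simp split: nat.split)
  then show ?case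
    by (cases j) simp_all
qed simp

lemma measurable_censor [measurable]:
  assumes "\<rho> \<in> borel_measurable M" "X \<in> M \<rightarrow>\<^sub>M (\<Pi>\<^sub>M i\<in>UNIV. borel)"
  shows "(\<lambda>w. censor a b K (\<rho> w) (X w)) \<in> M \<rightarrow>\<^sub>M (\<Pi>\<^sub>M i\<in>UNIV. borel)"
proof (rule measurable_PiM_single')
  fix j :: nat
  show "(\<lambda>w. censor a b K (\<rho> w) (X w) j) \<in> borel_measurable M"
    by (rule measurable_censor_nth) (use assms in measurable)
qed auto

text \<open>
  The decision to keep the \<open>k\<close>-th increment depends on the previous increments only, so keeping
  a subsequence in this way cannot be noticed in law.
\<close>

lemma distr_censor:
  assumes \<nu>: "prob_space \<nu>" and [measurable_cong]: "sets \<nu> = sets borel"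
  defines "S \<equiv> (\<Pi>\<^sub>M i\<in>(UNIV :: nat set). \<nu>)"
  shows "distr S S (censor a b K r) = S"
proof -
  interpret sequence_space \<nu> by (simp add: sequence_space_def product_prob_space_def
    product_prob_space_axioms_def product_sigma_finite_def \<nu> prob_space_imp_sigma_finite)
  have [measurable_cong]: "sets S = sets (\<Pi>\<^sub>M i\<in>(UNIV :: nat set). (borel :: real measure))"
    unfolding S_def by (rule sets_PiM_cong) (auto simp: assms(2))
  \<comment> \<open>An i.i.d. sequence is a first increment followed by an independent i.i.d.
    sequence. This serves twice: to peel off the first increment and to put it back.\<close>
  have iter: "distr (\<nu> \<Otimes>\<^sub>M S) S (\<lambda>(s, \<omega>). case_nat s \<omega>) = S"
    unfolding S_def by (rule PiM_iter)
  interpret S: prob_space S unfolding S_def by (rule prob_space_PiM) (simp add: \<nu>)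
  show ?thesis
  proof (induction K arbitrary: r)
    case 0
    show ?case by (simp add: distr_id)
  next
    case (Suc K)
    \<comment> \<open>\<open>G y z\<close> files the first increment \<open>y\<close> in front of
      the already censored tail \<open>z\<close>, or drops it; the choice depends on
      \<open>r\<close> alone.\<close>
    define G where "G y z = (if r \<le> b then case_nat y z else (z :: nat \<Rightarrow> real))" for y z
    have [measurable]: "(\<lambda>p. G (fst p) (snd p)) \<in> \<nu> \<Otimes>\<^sub>M S \<rightarrow>\<^sub>M S"
      unfolding G_def by measurable
    have G_y [measurable]: "G y \<in> S \<rightarrow>\<^sub>M S" for y
    proof -
      have "y \<in> space \<nu>" using sets_eq_imp_space_eq[OF assms(2)] by simp
      then have "(\<lambda>z. (y, z)) \<in> S \<rightarrow>\<^sub>M \<nu> \<Otimes>\<^sub>M S" by measurable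
      from measurable_compose[OF this \<open>(\<lambda>p. G (fst p) (snd p)) \<in> \<nu> \<Otimes>\<^sub>M S \<rightarrow>\<^sub>M S\<close>]
      show ?thesis by simp
    qed
    have [simp]: "space \<nu> = UNIV" "space S = UNIV"
      using sets_eq_imp_space_eq[OF assms(2)] by (auto simp: S_def space_PiM)
    define F where "F p = G (fst p) (censor a b K (clip a (r + fst p)) (snd p))"
      for p :: "real \<times> (nat \<Rightarrow> real)"
    have shifted: "(\<lambda>p. (fst p, censor a b K (clip a (r + fst p)) (snd p)))
        \<in> \<nu> \<Otimes>\<^sub>M S \<rightarrow>\<^sub>M \<nu> \<Otimes>\<^sub>M S"
      by measurable
    have [measurable]: "F \<in> \<nu> \<Otimes>\<^sub>M S \<rightarrow>\<^sub>M S"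
      using measurable_compose[OF shifted \<open>(\<lambda>p. G (fst p) (snd p)) \<in> \<nu> \<Otimes>\<^sub>M S \<rightarrow>\<^sub>M S\<close>]
      by (simp add: F_def[abs_def])
    have cens [measurable]: "censor a b K r' \<in> S \<rightarrow>\<^sub>M S" for K r'
      by measurable
    have FE: "censor a b (Suc K) r (case_nat y x) = F (y, x)" for y x
      by (simp add: F_def G_def)
    \<comment> \<open>Averaged over \<open>y\<close>, filing reproduces \<open>S\<close> by
      \<open>iter\<close>, and dropping leaves \<open>S\<close> as it is because \<nu> has mass
      1.\<close>
    have G: "(\<integral>\<^sup>+y. emeasure S (G y -` A) \<partial>\<nu>) = emeasure S A" if [measurable]: "A \<in> sets S" for A
    proof (cases "r \<le> b")
      case True
      have "emeasure S A = emeasure (distr (\<nu> \<Otimes>\<^sub>M S) S (\<lambda>(s, \<omega>). case_nat s \<omega>)) A"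
        by (simp only: iter)
      also have "\<dots> = (\<integral>\<^sup>+y. emeasure S (Pair y -` ((\<lambda>(s, \<omega>). case_nat s \<omega>) -` A \<inter> space (\<nu> \<Otimes>\<^sub>M S))) \<partial>\<nu>)"
        by (subst emeasure_distr, measurable) (rule S.emeasure_pair_measure_alt, measurable)
      finally show ?thesis
        using True by (simp add: G_def vimage_def space_pair_measure)
    next
      case False
      then have "G y -` A = A" for y by (simp add: G_def vimage_def)
      then show ?thesis
        using prob_space.emeasure_space_1[OF \<nu>] by (simp only: nn_integral_const mult_1_right)
    qed
    have "distr S S (censor a b (Suc K) r) =
        distr (distr (\<nu> \<Otimes>\<^sub>M S) S (\<lambda>(s, \<omega>). case_nat s \<omega>)) S (censor a b (Suc K) r)"
      by (simp only: iter)
    also have "\<dots> = distr (\<nu> \<Otimes>\<^sub>M S) S (censor a b (Suc K) r \<circ> (\<lambda>(s, \<omega>). case_nat s \<omega>))"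
      by (rule distr_distr) measurable
    also have "censor a b (Suc K) r \<circ> (\<lambda>(s, \<omega>). case_nat s \<omega>) = F"
      by (auto simp: FE fun_eq_iff simp del: censor.simps)
    also have "distr (\<nu> \<Otimes>\<^sub>M S) S F = S"
    proof (rule measure_eqI)
      fix A assume "A \<in> sets (distr (\<nu> \<Otimes>\<^sub>M S) S F)"
      then have A [measurable]: "A \<in> sets S" by simp
      have "emeasure (distr (\<nu> \<Otimes>\<^sub>M S) S F) A =
          (\<integral>\<^sup>+y. emeasure S (Pair y -` (F -` A \<inter> space (\<nu> \<Otimes>\<^sub>M S))) \<partial>\<nu>)"
        by (subst emeasure_distr, measurable) (rule S.emeasure_pair_measure_alt, measurable)
      also have "\<dots> = (\<integral>\<^sup>+y. emeasure S (G y -` A) \<partial>\<nu>)"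
      \<comment> \<open>Given \<open>y\<close>, the tail restarts at the fixed point
        \<open>clip a (r + y)\<close>, and the induction hypothesis for that start replaces the
        censored tail by \<open>S\<close>.\<close>
      proof (rule nn_integral_cong)
        fix y
        have "emeasure S (Pair y -` (F -` A \<inter> space (\<nu> \<Otimes>\<^sub>M S))) =
           emeasure S (censor a b K (clip a (r + y)) -` (G y -` A) \<inter> space S)"
          by (simp add: F_def vimage_def space_pair_measure)
        also have "\<dots> = emeasure (distr S S (censor a b K (clip a (r + y)))) (G y -` A)"
          using measurable_sets[OF G_y A] by (intro emeasure_distr[symmetric] cens) simp
        also have "\<dots> = emeasure S (G y -` A)" by (simp only: Suc.IH)
        finally show "emeasure S (Pair y -` (F -` A \<inter> space (\<nu> \<Otimes>\<^sub>M S))) = emeasure S (G y -` A)" .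
      qed
      also have "\<dots> = emeasure S A" by (rule G) measurable
      finally show "emeasure (distr (\<nu> \<Otimes>\<^sub>M S) S F) A = emeasure S A" .
    qed simp
    finally show ?case .
  qed
qed

section \<open>Local time at the boundary\<close>

lemma sets_path_preimage:
  fixes \<phi> :: "real \<Rightarrow> real"
  assumes "continuous_on {0..} \<phi>" "0 \<le> s" "closed B"
  shows "{u \<in> {s..t}. \<phi> u \<in> B} \<in> sets lborel" "{u \<in> {s<..t}. \<phi> u \<in> B} \<in> sets lborel"
proof -
  have "continuous_on {s..t} \<phi>" using assms(1,2) by (auto intro: continuous_on_subset)
  then have "closed ({s..t} \<inter> \<phi> -` B)"
    using \<open>closed B\<close> by (intro continuous_closed_preimage) auto
  then have "{u \<in> {s..t}. \<phi> u \<in> B} \<in> sets borel" by (simp add: Int_def vimage_def)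
  then show *: "{u \<in> {s..t}. \<phi> u \<in> B} \<in> sets lborel" by simp
  have "{u \<in> {s<..t}. \<phi> u \<in> B} = {u \<in> {s..t}. \<phi> u \<in> B} - {s}" by auto
  with * show "{u \<in> {s<..t}. \<phi> u \<in> B} \<in> sets lborel" by simp
qed

lemma measure_path_preimage_diff:
  fixes \<phi> :: "real \<Rightarrow> real"
  assumes "continuous_on {0..} \<phi>" "0 \<le> s" "s \<le> t" "closed B"
  shows "measure lborel {u \<in> {0..t}. \<phi> u \<in> B} - measure lborel {u \<in> {0..s}. \<phi> u \<in> B} =
    measure lborel {u \<in> {s<..t}. \<phi> u \<in> B}"
proof -
  have "emeasure lborel {u \<in> {0..t}. \<phi> u \<in> B} \<le> emeasure lborel {0..t}"
    by (rule emeasure_mono) auto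
  also have "\<dots> < \<infinity>" using assms(2,3) by simp
  finally have fin: "{u \<in> {0..t}. \<phi> u \<in> B} \<in> fmeasurable lborel"
    using sets_path_preimage(1)[OF assms(1) _ \<open>closed B\<close>, of 0 t]
    by (intro fmeasurableI) auto
  have "{u \<in> {s<..t}. \<phi> u \<in> B} = {u \<in> {0..t}. \<phi> u \<in> B} - {u \<in> {0..s}. \<phi> u \<in> B}"
    using assms(2,3) by auto
  moreover have "measure lborel ({u \<in> {0..t}. \<phi> u \<in> B} - {u \<in> {0..s}. \<phi> u \<in> B}) =
      measure lborel {u \<in> {0..t}. \<phi> u \<in> B} - measure lborel {u \<in> {0..s}. \<phi> u \<in> B}"
    by (rule measurable_measure_Diff[OF fin]) (use sets_path_preimage(1)[OF assms(1) _ \<open>closed B\<close>, of 0 s] assms(3) in auto)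
  ultimately show ?thesis by simp
qed

text \<open>The occupation formula controls integrals over levels only. Its increments in time are
  occupation measures of bands \<open>{p..q}\<close>: nonnegative, and zero when the band is not
  visited. Continuity in the level then brings this down to single levels.\<close>

lemma local_time_increment:
  assumes L: "is_local_time c \<phi> L" and \<phi>: "\<phi> \<in> cont_paths c"
    and "0 \<le> s" "s \<le> t" "0 \<le> p" "p \<le> q" "q \<le> c"
  shows "(LINT r:{p..q}|lborel. L r t - L r s) = measure lborel {u \<in> {s<..t}. \<phi> u \<in> {p..q}}"
proof -
  have cont: "continuous_on ({0..c} \<times> {0..}) (\<lambda>(r, t). L r t)"
    and occ: "\<And>t B. 0 \<le> t \<Longrightarrow> B \<in> sets borel \<Longrightarrow> B \<subseteq> {0..c} \<Longrightarrow>
        measure lborel {s \<in> {0..t}. \<phi> s \<in> B} = (LINT r:B|lborel. L r t)"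
    using L by (auto simp: is_local_time_def)
  have int: "set_integrable lborel {p..q} (\<lambda>r. L r v)" if "0 \<le> v" for v
  proof (rule borel_integrable_atLeastAtMost')
    have "continuous_on {p..q} ((\<lambda>(r, t). L r t) \<circ> (\<lambda>r. (r, v)))"
      by (rule continuous_on_compose, intro continuous_intros,
          rule continuous_on_subset[OF cont]) (use that assms in auto)
    then show "continuous_on {p..q} (\<lambda>r. L r v)" by (simp add: comp_def)
  qed
  have "(LINT r:{p..q}|lborel. L r t - L r s) = (LINT r:{p..q}|lborel. L r t) - (LINT r:{p..q}|lborel. L r s)"
    by (rule set_integral_diff(2); rule int) (use assms in auto)
  also have "\<dots> = measure lborel {u \<in> {0..t}. \<phi> u \<in> {p..q}} - measure lborel {u \<in> {0..s}. \<phi> u \<in> {p..q}}"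
    using assms by (subst (1 2) occ) auto
  also have "\<dots> = measure lborel {u \<in> {s<..t}. \<phi> u \<in> {p..q}}"
    by (rule measure_path_preimage_diff) (use assms in \<open>auto simp: cont_paths_def\<close>)
  finally show ?thesis .
qed

lemma local_time_continuous_level:
  assumes "is_local_time c \<phi> L" "0 \<le> t"
  shows "continuous_on {0..c} (\<lambda>r. L r t)"
proof -
  have "continuous_on {0..c} ((\<lambda>(r, t). L r t) \<circ> (\<lambda>r. (r, t)))"
    by (rule continuous_on_compose, intro continuous_intros, rule continuous_on_subset[of "{0..c} \<times> {0..}"])
      (use assms in \<open>auto simp: is_local_time_def\<close>)
  then show ?thesis by (simp add: comp_def)
qed

text \<open>A negative value persists near \<open>r\<close>. The band is cut at 0 and at
  \<open>c\<close>, so that \<open>r\<close> may be a boundary level, which is the case of interest;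
  \<open>e0\<close> keeps the band close to \<open>r\<close>.\<close>

lemma continuous_neg_nbhd:
  fixes D :: "real \<Rightarrow> real"
  assumes "continuous_on {0..c} D" "0 < c" "r \<in> {0..c}" "D r < 0" "0 < e0"
  obtains p q where "0 \<le> p" "p < q" "q \<le> c" "r - e0 < p" "q < r + e0" "(LINT x:{p..q}|lborel. D x) < 0"
proof -
  obtain e where e: "0 < e" "\<And>x. x \<in> {0..c} \<Longrightarrow> \<bar>x - r\<bar> < e \<Longrightarrow> \<bar>D x - D r\<bar> < - D r / 2"
    using assms(1,3,4) unfolding continuous_on_iff dist_real_def by (metis half_gt_zero neg_0_less_iff_less)
  define e' where "e' = min e e0 / 2"
  have e': "0 < e'" "e' < e" "e' < e0" using e assms(5) by (auto simp: e'_def min_def)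
  define p q where "p = max 0 (r - e')" and "q = min c (r + e')"
  have pq: "0 \<le> p" "p < q" "q \<le> c" "r - e0 < p" "q < r + e0" "p \<le> r" "r \<le> q"
    using assms e' by (auto simp: p_def q_def)
  have D: "D x \<le> D r / 2" if "x \<in> {p..q}" for x
  proof -
    have "x \<in> {0..c}" "\<bar>x - r\<bar> < e" using that pq e' by (auto simp: p_def q_def)
    from e(2)[OF this] show ?thesis by (auto simp: abs_if field_simps split: if_splits)
  qed
  have "(LINT x:{p..q}|lborel. D x) \<le> (LINT x:{p..q}|lborel. D r / 2)"
    using pq D by (intro set_integral_mono borel_integrable_atLeastAtMost' continuous_on_const
        continuous_on_subset[OF assms(1)]) auto
  also have "\<dots> = (q - p) * (D r / 2)"
    using pq by (simp add: set_lebesgue_integral_def)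
  also have "\<dots> < 0" using pq assms(4) by (simp add: mult_pos_neg)
  finally show ?thesis using that pq by blast
qed

text \<open>A decrease at one level would spread to a band whose occupation time between
  \<open>s\<close> and \<open>t\<close> is negative.\<close>

lemma local_time_mono:
  assumes L: "is_local_time c \<phi> L" and \<phi>: "\<phi> \<in> cont_paths c" and "0 < c" "r \<in> {0..c}"
    and st: "0 \<le> s" "s \<le> t"
  shows "L r s \<le> L r t"
proof (rule ccontr)
  assume "\<not> L r s \<le> L r t"
  then have "L r t - L r s < 0" by simp
  moreover have "continuous_on {0..c} (\<lambda>r. L r t - L r s)"
    using st by (intro continuous_intros local_time_continuous_level[OF L]) auto
  ultimately obtain p q where pq: "0 \<le> p" "p < q" "q \<le> c"
    and neg: "(LINT x:{p..q}|lborel. L x t - L x s) < 0"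
    using assms continuous_neg_nbhd[of c "\<lambda>r. L r t - L r s" r 1] by (metis zero_less_one)
  from local_time_increment[OF L \<phi> st] pq neg show False
    by (simp add: not_less[symmetric])
qed

text \<open>The image of \<open>{s..t}\<close> is compact, so a missed level has a whole unvisited
  band around it, over which the increment of \<open>L\<close> integrates to 0.\<close>

lemma local_time_flat:
  assumes L: "is_local_time c \<phi> L" and \<phi>: "\<phi> \<in> cont_paths c" and "0 < c" "r \<in> {0..c}"
    and st: "0 \<le> s" "s \<le> t" and away: "\<And>u. u \<in> {s..t} \<Longrightarrow> \<phi> u \<noteq> r"
  shows "L r s = L r t"
proof (rule antisym)
  show "L r s \<le> L r t" by (rule local_time_mono) fact+
  show "L r t \<le> L r s"
  proof (rule ccontr)
    assume "\<not> L r t \<le> L r s"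
    then have neg: "L r s - L r t < 0" by simp
    have "continuous_on {s..t} \<phi>"
      using \<phi> st by (auto simp: cont_paths_def intro: continuous_on_subset)
    then have "compact (\<phi> ` {s..t})" by (rule compact_continuous_image) simp
    then have "open (- \<phi> ` {s..t})" by (simp add: compact_imp_closed open_Compl)
    moreover have "r \<in> - \<phi> ` {s..t}" using away by blast
    ultimately obtain e0 where e0: "0 < e0" "ball r e0 \<subseteq> - \<phi> ` {s..t}"
      by (meson open_contains_ball)
    have "continuous_on {0..c} (\<lambda>r. L r s - L r t)"
      using st by (intro continuous_intros local_time_continuous_level[OF L]) auto
    with neg obtain p q where pq: "0 \<le> p" "p < q" "q \<le> c" "r - e0 < p" "q < r + e0"
      and int: "(LINT x:{p..q}|lborel. L x s - L x t) < 0"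
      using assms e0 continuous_neg_nbhd[of c "\<lambda>r. L r s - L r t" r e0] by metis
    have "{p..q} \<subseteq> ball r e0" using pq by (auto simp: dist_real_def)
    with e0 have "{u \<in> {s<..t}. \<phi> u \<in> {p..q}} = {}" by fastforce
    then have "(LINT x:{p..q}|lborel. L x t - L x s) = 0"
      using local_time_increment[OF L \<phi> st, of p q] pq by (simp only: less_imp_le measure_empty)
    moreover have "(LINT x:{p..q}|lborel. - (L x t - L x s)) = - (LINT x:{p..q}|lborel. L x t - L x s)"
      unfolding set_lebesgue_integral_def scaleR_minus_right by (rule integral_minus)
    ultimately have "(LINT x:{p..q}|lborel. - (L x t - L x s)) = 0"
      by (simp only: neg_equal_0_iff_equal)
    then show False using int by (simp only: minus_diff_eq less_irrefl)
  qed
qed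

text \<open>A single level is Lebesgue null. The case \<open>r = b\<close> matters, since the
  indicator of \<open>{..b}\<close> jumps there.\<close>

lemma local_time_level_null:
  assumes L: "is_local_time c \<phi> L" and "0 \<le> t" "r \<in> {0..c}"
  shows "measure lborel {s \<in> {0..t}. \<phi> s = r} = 0"
proof -
  have "\<And>B. B \<in> sets borel \<Longrightarrow> B \<subseteq> {0..c} \<Longrightarrow>
      measure lborel {s \<in> {0..t}. \<phi> s \<in> B} = (LINT r:B|lborel. L r t)"
    using L \<open>0 \<le> t\<close> by (simp add: is_local_time_def)
  from this[of "{r}"] have "measure lborel {s \<in> {0..t}. \<phi> s \<in> {r}} = (LINT x:{r}|lborel. L x t)"
    using \<open>r \<in> {0..c}\<close> by simp
  also have "\<dots> = 0"
    unfolding set_lebesgue_integral_def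
    by (rule integral_eq_zero_AE, rule eventually_mono[OF AE_lborel_singleton[of r]]) simp
  finally show ?thesis by simp
qed

section \<open>The clock below a level\<close>

locale clocked_path =
  fixes \<phi> :: "real \<Rightarrow> real" and b :: real
  assumes path_cont: "continuous_on {0..} \<phi>"
begin

abbreviation "A \<equiv> time_below b \<phi>"

lemma time_below_eq: "A t = measure lborel {s \<in> {0..t}. \<phi> s \<in> {..b}}"
proof -
  have "A t = (LINT s|lborel. indicator {s \<in> {0..t}. \<phi> s \<in> {..b}} s)"
    unfolding time_below_def set_lebesgue_integral_def
    by (intro Bochner_Integration.integral_cong) (auto simp: indicator_def)
  then show ?thesis by simp
qed

lemma time_below_diff:
  "0 \<le> s \<Longrightarrow> s \<le> t \<Longrightarrow> A t - A s = measure lborel {u \<in> {s<..t}. \<phi> u \<in> {..b}}"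
  unfolding time_below_eq by (rule measure_path_preimage_diff[OF path_cont]) auto

lemma time_below_0 [simp]: "A 0 = 0"
proof -
  have "{s \<in> {0..0}. \<phi> s \<in> {..b}} = (if \<phi> 0 \<le> b then {0} else {})" by auto
  then show ?thesis unfolding time_below_eq by simp
qed

lemma time_below_mono: "0 \<le> s \<Longrightarrow> s \<le> t \<Longrightarrow> A s \<le> A t"
  using time_below_diff[of s t] measure_nonneg[of lborel "{u \<in> {s<..t}. \<phi> u \<in> {..b}}"] by linarith

lemma time_below_nonneg: "0 \<le> t \<Longrightarrow> 0 \<le> A t"
  using time_below_mono[of 0 t] by simp

lemma time_below_diff_le: assumes "0 \<le> s" "s \<le> t" shows "A t - A s \<le> t - s"
proof -
  have "measure lborel {u \<in> {s<..t}. \<phi> u \<in> {..b}} \<le> measure lborel {s<..t}"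
  proof (rule measure_mono_fmeasurable)
    show "{u \<in> {s<..t}. \<phi> u \<in> {..b}} \<in> sets lborel"
      by (rule sets_path_preimage(2)[OF path_cont]) (use assms in auto)
    show "{s<..t} \<in> fmeasurable lborel"
      using assms by (intro fmeasurableI) auto
  qed auto
  then show ?thesis using time_below_diff assms by simp
qed

lemma time_below_lipschitz: "0 \<le> s \<Longrightarrow> 0 \<le> t \<Longrightarrow> \<bar>A t - A s\<bar> \<le> \<bar>t - s\<bar>"
  using time_below_diff_le[of s t] time_below_diff_le[of t s] time_below_mono[of s t] time_below_mono[of t s]
  by linarith

lemma time_below_continuous: "continuous_on {0..} A"
  unfolding continuous_on_iff dist_real_def
  using time_below_lipschitz by (metis atLeast_iff le_less_trans)

lemma time_below_inside:
  assumes "0 \<le> s" "s \<le> t" "\<And>u. u \<in> {s<..t} \<Longrightarrow> \<phi> u \<le> b"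
  shows "A t - A s = t - s"
proof -
  have "{u \<in> {s<..t}. \<phi> u \<in> {..b}} = {s<..t}" using assms by auto
  then show ?thesis using time_below_diff assms by simp
qed

lemma time_below_outside:
  assumes "0 \<le> s" "s \<le> t" "\<And>u. u \<in> {s<..t} \<Longrightarrow> b < \<phi> u"
  shows "A t = A s"
proof -
  have "{u \<in> {s<..t}. \<phi> u \<in> {..b}} = {}" using assms(3) by fastforce
  then have "A t - A s = 0" using time_below_diff[OF assms(1,2)] by (simp only: measure_empty)
  then show ?thesis by simp
qed

lemma path_nbhd:
  assumes "0 \<le> s" "open U" "\<phi> s \<in> U"
  obtains e where "0 < e" "\<And>u. 0 \<le> u \<Longrightarrow> \<bar>u - s\<bar> \<le> e \<Longrightarrow> \<phi> u \<in> U"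
proof -
  obtain d where d: "0 < d" "\<And>y. dist y (\<phi> s) < d \<Longrightarrow> y \<in> U"
    using assms(2,3) unfolding open_dist by blast
  obtain e where "0 < e" "\<And>u. u \<in> {0..} \<Longrightarrow> dist u s < e \<Longrightarrow> dist (\<phi> u) (\<phi> s) < d"
    using path_cont assms(1) d(1) unfolding continuous_on_iff by (meson atLeast_iff)
  then show ?thesis using d(2) by (intro that[of "e / 2"]) (auto simp: dist_real_def)
qed

text \<open>A dip strictly below \<open>b\<close> lasts for a nondegenerate interval, on which the
  clock runs at unit speed. The path may touch \<open>b\<close> on a flat stretch.\<close>

lemma time_below_flat:
  assumes "0 \<le> s" "s < t" "A s = A t" "s \<le> u" "u \<le> t"
  shows "b \<le> \<phi> u"
proof (rule ccontr)
  assume "\<not> b \<le> \<phi> u"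
  then obtain e where e: "0 < e" "\<And>v. 0 \<le> v \<Longrightarrow> \<bar>v - u\<bar> \<le> e \<Longrightarrow> \<phi> v \<in> {..<b}"
    using path_nbhd[of u "{..<b}"] assms by auto
  define p q where "p = max s (u - e)" and "q = min t (u + e)"
  have pq: "s \<le> p" "p < q" "q \<le> t" using assms e by (auto simp: p_def q_def)
  have "\<phi> v \<le> b" if "v \<in> {p<..q}" for v
    using e(2)[of v] that pq assms(1) by (auto simp: p_def q_def abs_le_iff)
  then have "A q - A p = q - p"
    using pq assms(1) by (intro time_below_inside) auto
  moreover have "A s \<le> A p" "A q \<le> A t"
    by (rule time_below_mono; use pq assms(1) in linarith)+
  ultimately show False using pq assms(3) by linarith
qed

section \<open>The inverse clock at a time that the clock exceeds\<close>

context
  fixes t assumes t: "0 \<le> t" and reached: "\<exists>r\<ge>0. t < A r"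
begin

text \<open>The strict inequality selects the last time at which the clock reads \<open>t\<close>,
  the end of a possible flat stretch.\<close>

definition "inv_clock = Inf {r. 0 \<le> r \<and> t < A r}"

lemma inv_clock_set: "{r. 0 \<le> r \<and> t < A r} \<noteq> {}" "bdd_below {r. 0 \<le> r \<and> t < A r}"
  using reached by (auto intro: bdd_belowI)

lemma inv_clock_le: "0 \<le> r \<Longrightarrow> t < A r \<Longrightarrow> inv_clock \<le> r"
  unfolding inv_clock_def by (rule cInf_lower) (use inv_clock_set in auto)

lemma inv_clock_nonneg: "0 \<le> inv_clock"
  unfolding inv_clock_def by (rule cInf_greatest) (use inv_clock_set in auto)

lemma inv_clock_approx: assumes "inv_clock < s" obtains r where "0 \<le> r" "t < A r" "inv_clock \<le> r" "r < s"
  using assms inv_clock_set cInf_less_iff[of "{r. 0 \<le> r \<and> t < A r}" s] inv_clock_le unfolding inv_clock_def by blast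

lemma path_proj_eq: "path_proj b \<phi> t = \<phi> inv_clock"
proof -
  have "inv_time_below b \<phi> t = ereal inv_clock"
    unfolding inv_time_below_def inv_clock_def using inv_clock_set by (intro ereal_Inf'[symmetric])
  then show ?thesis by (simp add: path_proj_def)
qed

lemma time_below_inv_clock: "A inv_clock = t"
proof (rule antisym)
  show "t \<le> A inv_clock"
  proof (rule field_le_epsilon)
    fix e :: real assume "0 < e"
    then obtain r where "0 \<le> r" "t < A r" "inv_clock \<le> r" "r < inv_clock + e" using inv_clock_approx[of "inv_clock + e"] by auto
    then show "t \<le> A inv_clock + e" using time_below_diff_le[of inv_clock r] inv_clock_nonneg by linarith
  qed
  show "A inv_clock \<le> t"
  proof (rule ccontr)
    assume *: "\<not> A inv_clock \<le> t"
    have "0 < inv_clock" using inv_clock_nonneg * t by (cases "inv_clock = 0") auto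
    define s where "s = max 0 (inv_clock - (A inv_clock - t) / 2)"
    have s: "0 \<le> s" "s < inv_clock" "inv_clock - s \<le> (A inv_clock - t) / 2" using * \<open>0 < inv_clock\<close> by (auto simp: s_def max_def)
    then have "t < A s" using time_below_diff_le[of s inv_clock] * by (simp add: field_simps)
    then show False using inv_clock_le[of s] s by simp
  qed
qed

text \<open>Above \<open>b\<close> the clock would stand still for a while after
  \<open>inv_clock\<close>, but there are times arbitrarily close on the right at which it exceeds
  \<open>t\<close>.\<close>

lemma path_inv_clock_le: "\<phi> inv_clock \<le> b"
proof (rule ccontr)
  assume "\<not> \<phi> inv_clock \<le> b"
  then obtain e where e: "0 < e" "\<And>v. 0 \<le> v \<Longrightarrow> \<bar>v - inv_clock\<bar> \<le> e \<Longrightarrow> \<phi> v \<in> {b<..}"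
    using path_nbhd[of inv_clock "{b<..}"] inv_clock_nonneg by auto
  obtain r where r: "0 \<le> r" "t < A r" "inv_clock \<le> r" "r < inv_clock + e" using inv_clock_approx[of "inv_clock + e"] e by auto
  have "A r = A inv_clock"
    by (rule time_below_outside) (use e(2) r inv_clock_nonneg in \<open>fastforce+\<close>)
  then show False using r time_below_inv_clock by simp
qed

text \<open>Two distinct times with the same reading bound a flat stretch, where the path is at
  least \<open>b\<close>; being at most \<open>b\<close> at both, it equals \<open>b\<close> at
  both. So it does not matter which such time is hit.\<close>

lemma path_at_clock_value:
  assumes "0 \<le> s" "A s = t" "\<phi> s \<le> b"
  shows "\<phi> s = path_proj b \<phi> t"
proof (cases s inv_clock rule: linorder_cases)
  case less
  then have "b \<le> \<phi> s" "b \<le> \<phi> inv_clock"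
    using time_below_flat[of s inv_clock] time_below_inv_clock assms by auto
  then show ?thesis using assms path_inv_clock_le path_proj_eq by simp
next
  case greater
  then obtain r where "0 \<le> r" "t < A r" "inv_clock \<le> r" "r < s" by (rule inv_clock_approx)
  then show ?thesis using time_below_mono[of r s] assms by simp
qed (simp add: path_proj_eq)

text \<open>The times \<open>s n\<close> need not converge. By compactness a bad subsequence has a
  limit point \<open>l\<close> with reading \<open>t\<close> and \<open>\<phi> l \<le> b\<close>,
  and \<open>path_at_clock_value\<close> identifies the path value there.\<close>

lemma tendsto_path_proj:
  assumes s: "\<forall>\<^sub>F n in sequentially. s n \<in> {0..R}" and As: "(\<lambda>n. A (s n)) \<longlonglongrightarrow> t"
    and le: "\<And>e. 0 < e \<Longrightarrow> \<forall>\<^sub>F n in sequentially. \<phi> (s n) \<le> b + e"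
  shows "(\<lambda>n. \<phi> (s n)) \<longlonglongrightarrow> path_proj b \<phi> t"
proof (rule ccontr)
  assume "\<not> ?thesis"
  then obtain e where e: "0 < e" "\<exists>\<^sub>F n in sequentially. e \<le> dist (\<phi> (s n)) (path_proj b \<phi> t)"
    unfolding tendsto_iff frequently_def not_le by blast
  have "\<not> (\<forall>\<^sub>F n in sequentially. \<not> (e \<le> dist (\<phi> (s n)) (path_proj b \<phi> t) \<and> s n \<in> {0..R}))"
    using frequently_eventually_frequently[OF e(2) s] unfolding frequently_def .
  from not_eventually_sequentiallyD[OF this]
  obtain f :: "nat \<Rightarrow> nat" where f: "strict_mono f"
    "\<And>n. e \<le> dist (\<phi> (s (f n))) (path_proj b \<phi> t) \<and> s (f n) \<in> {0..R}"
    by blast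
  obtain l g where lg: "l \<in> {0..R}" "strict_mono (g :: nat \<Rightarrow> nat)" "((s \<circ> f) \<circ> g) \<longlonglongrightarrow> l"
    using seq_compactE[of "{0..R}" "s \<circ> f"] f(2) compact_imp_seq_compact[of "{0..R}"] by auto
  define h where "h = f \<circ> g"
  have h: "strict_mono h" using f(1) lg(2) by (auto simp: h_def strict_mono_o)
  have lim: "(\<lambda>n. s (h n)) \<longlonglongrightarrow> l" using lg(3) by (simp add: h_def comp_def)
  have sh: "s (h n) \<in> {0..}" for n using f(2) by (auto simp: h_def)
  have "(\<lambda>n. A (s (h n))) \<longlonglongrightarrow> A l"
    using continuous_on_tendsto_compose[OF time_below_continuous lim] lg(1) sh by auto
  moreover have "(\<lambda>n. A (s (h n))) \<longlonglongrightarrow> t"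
    using LIMSEQ_subseq_LIMSEQ[OF As h] by (simp add: comp_def)
  ultimately have "A l = t" by (rule LIMSEQ_unique)
  have phi: "(\<lambda>n. \<phi> (s (h n))) \<longlonglongrightarrow> \<phi> l"
    using continuous_on_tendsto_compose[OF path_cont lim] lg(1) sh by auto
  have "\<phi> l \<le> b"
  proof (rule field_le_epsilon)
    fix d :: real assume "0 < d"
    then have "\<forall>\<^sub>F n in sequentially. \<phi> (s (h n)) \<le> b + d"
      by (intro eventually_subseq[OF h] le)
    with phi show "\<phi> l \<le> b + d" by (intro tendsto_upperbound[OF phi]) auto
  qed
  with \<open>A l = t\<close> lg(1) have "\<phi> l = path_proj b \<phi> t" by (intro path_at_clock_value) auto
  with phi have "\<forall>\<^sub>F n in sequentially. dist (\<phi> (s (h n))) (path_proj b \<phi> t) < e"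
    using e(1) by (auto simp: tendsto_iff)
  then show False using f(2) by (auto simp: h_def not_less[symmetric] dest: eventually_happens)
qed

end

text \<open>The inverse clock may jump across excursions above \<open>b\<close>, so continuity
  cannot come from composition; \<open>tendsto_path_proj\<close> is applied to the inverse times.
  Unboundedness of the clock confines them to a compact interval.\<close>

lemma path_proj_continuous:
  assumes inf: "\<And>T. \<exists>r\<ge>0. T < A r"
  shows "continuous_on {0..} (path_proj b \<phi>)"
  unfolding continuous_on_sequentially
proof (intro allI ballI impI, elim conjE)
  fix X and t :: real
  assume X: "\<forall>n. X n \<in> {0..}" "X \<longlonglongrightarrow> t" and "t \<in> {0..}"
  then have t: "0 \<le> t" by simp
  obtain R where R: "0 \<le> R" "t + 1 < A R" using inf by blast
  define s where "s n = inv_clock (X n)" for n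
  have s: "0 \<le> s n" "A (s n) = X n" "\<phi> (s n) \<le> b" "path_proj b \<phi> (X n) = \<phi> (s n)" for n
    using X(1) inf by (auto simp: s_def inv_clock_nonneg time_below_inv_clock path_inv_clock_le path_proj_eq)
  have "\<forall>\<^sub>F n in sequentially. X n < t + 1"
    using X(2) by (rule order_tendstoD) simp
  then have ev: "\<forall>\<^sub>F n in sequentially. s n \<in> {0..R}"
  proof eventually_elim
    case (elim n)
    then show ?case
      using s[of n] R inv_clock_le[OF _ inf, of "X n" R] X(1) by (auto simp: s_def)
  qed
  have "(\<lambda>n. \<phi> (s n)) \<longlonglongrightarrow> path_proj b \<phi> t"
    using s(2,3) X(2) by (intro tendsto_path_proj[OF t inf ev] always_eventually allI)
      (simp_all add: add_increasing2)
  then show "(path_proj b \<phi> \<circ> X) \<longlonglongrightarrow> path_proj b \<phi> t"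
    by (simp add: comp_def s(4))
qed

lemma path_proj_in_cont_paths:
  assumes "\<And>T. \<exists>r\<ge>0. T < A r" "\<And>t. 0 \<le> t \<Longrightarrow> 0 \<le> \<phi> t"
  shows "path_proj b \<phi> \<in> cont_paths b"
  using path_proj_continuous[OF assms(1)] path_proj_eq[OF _ assms(1)] path_inv_clock_le[OF _ assms(1)]
    assms(2) inv_clock_nonneg[OF _ assms(1)]
  by (auto simp: cont_paths_def)

end

section \<open>Discretisation of the two-sided reflection\<close>

definition increments :: "(real \<Rightarrow> real) \<Rightarrow> nat \<Rightarrow> nat \<Rightarrow> real" where
  "increments w n k = w (real (Suc k) / real n) - w (real k / real n)"

text \<open>The Skorokhod problem in \<open>{0..c}\<close> driven by \<open>w\<close>, with pushes
  \<open>l\<close> at 0 and \<open>u\<close> at \<open>c\<close>. Flatness on intervals free of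
  boundary contact replaces the Stieltjes condition that the pushes grow only at the
  boundary.\<close>

definition two_sided_reflection :: "real \<Rightarrow> (real \<Rightarrow> real) \<Rightarrow> (real \<Rightarrow> real) \<Rightarrow> bool" where
  "two_sided_reflection c w \<phi> \<longleftrightarrow> \<phi> \<in> cont_paths c \<and> \<phi> 0 = 0 \<and>
     (\<exists>l u. (\<forall>t\<ge>0. \<phi> t = w t + l t - u t) \<and>
       (\<forall>s t. 0 \<le> s \<and> s \<le> t \<longrightarrow> l s \<le> l t \<and> u s \<le> u t \<and>
         ((\<forall>v\<in>{s..t}. \<phi> v \<noteq> 0) \<longrightarrow> l s = l t) \<and> ((\<forall>v\<in>{s..t}. \<phi> v \<noteq> c) \<longrightarrow> u s = u t)))"

lemma two_sided_reflection_local_time: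
  assumes "is_local_time c \<phi> L" "\<phi> \<in> cont_paths c" "0 < c" "\<phi> 0 = 0"
    and "\<And>t. 0 \<le> t \<Longrightarrow> \<phi> t = w t + 1/2 * L 0 t - 1/2 * L c t"
  shows "two_sided_reflection c w \<phi>"
proof -
  define l u where "l t = 1/2 * L 0 t" and "u t = 1/2 * L c t" for t
  have "\<forall>t\<ge>0. \<phi> t = w t + l t - u t" using assms(5) by (simp add: l_def u_def)
  moreover have "l s \<le> l t \<and> u s \<le> u t \<and>
      ((\<forall>v\<in>{s..t}. \<phi> v \<noteq> 0) \<longrightarrow> l s = l t) \<and> ((\<forall>v\<in>{s..t}. \<phi> v \<noteq> c) \<longrightarrow> u s = u t)"
    if "0 \<le> s \<and> s \<le> t" for s t
    using that \<open>0 < c\<close> local_time_mono[OF assms(1-3), of _ s t] local_time_flat[OF assms(1-3), of _ s t]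
    by (simp add: l_def u_def)
  ultimately show ?thesis
    using assms(2,4) unfolding two_sided_reflection_def by blast
qed

lemma eventually_mesh_oscillation:
  fixes \<phi> :: "real \<Rightarrow> real"
  assumes "continuous_on {0..} \<phi>" "0 < e"
  shows "\<forall>\<^sub>F n in sequentially. \<forall>s\<in>{0..R}. \<forall>t\<in>{0..R}. \<bar>s - t\<bar> \<le> 1 / real n \<longrightarrow> \<bar>\<phi> s - \<phi> t\<bar> \<le> e"
proof -
  have "uniformly_continuous_on {0..R} \<phi>"
    using assms(1) by (intro compact_uniformly_continuous) (auto intro: continuous_on_subset)
  then obtain d where d: "0 < d"
    "\<And>s t. s \<in> {0..R} \<Longrightarrow> t \<in> {0..R} \<Longrightarrow> \<bar>s - t\<bar> < d \<Longrightarrow> \<bar>\<phi> s - \<phi> t\<bar> < e"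
    unfolding uniformly_continuous_on_def dist_real_def using assms(2) by meson
  have "\<forall>\<^sub>F n in sequentially. 1 / real n < d"
    using d(1) by (intro order_tendstoD(2)[OF lim_1_over_n])
  then show ?thesis
    by eventually_elim (use d(2) in \<open>fastforce intro: less_imp_le\<close>)
qed

lemma mesh_mem:
  assumes "0 < n" "k \<le> n * R"
  shows "real k / real n \<in> {0..real R}"
proof -
  have "real k \<le> real n * real R" using assms(2) by (metis of_nat_le_iff of_nat_mult)
  then show ?thesis using assms(1) by (simp add: divide_le_eq mult.commute)
qed

text \<open>A push over a mesh cell means boundary contact inside the cell, so at the right end
  \<phi> is within its oscillation \<open>e\<close> of that boundary. These are the hypotheses of
  \<open>reflected_walk_close\<close>; the error is thus bounded by the modulus of continuity of
  \<phi>, uniformly in \<open>k\<close>.\<close>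

lemma reflected_walk_approx:
  assumes \<phi>: "two_sided_reflection c w \<phi>" and "0 < c" "0 < e"
  shows "\<forall>\<^sub>F n in sequentially. \<forall>k\<le>n * R. \<bar>reflected_walk c 0 (increments w n) k - \<phi> (real k / real n)\<bar> \<le> e"
proof -
  obtain l u where cont: "continuous_on {0..} \<phi>" and mem: "\<And>t. 0 \<le> t \<Longrightarrow> \<phi> t \<in> {0..c}" and "\<phi> 0 = 0"
    and eq: "\<And>t. 0 \<le> t \<Longrightarrow> \<phi> t = w t + l t - u t"
    and mono: "\<And>s t. 0 \<le> s \<Longrightarrow> s \<le> t \<Longrightarrow> l s \<le> l t" "\<And>s t. 0 \<le> s \<Longrightarrow> s \<le> t \<Longrightarrow> u s \<le> u t"
    and flat: "\<And>s t. 0 \<le> s \<Longrightarrow> s \<le> t \<Longrightarrow> \<forall>v\<in>{s..t}. \<phi> v \<noteq> 0 \<Longrightarrow> l s = l t"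
      "\<And>s t. 0 \<le> s \<Longrightarrow> s \<le> t \<Longrightarrow> \<forall>v\<in>{s..t}. \<phi> v \<noteq> c \<Longrightarrow> u s = u t"
    using \<phi> unfolding two_sided_reflection_def cont_paths_def by blast
  have "\<forall>\<^sub>F n in sequentially. 0 < n \<and>
      (\<forall>s\<in>{0..real R}. \<forall>t\<in>{0..real R}. \<bar>s - t\<bar> \<le> 1 / real n \<longrightarrow> \<bar>\<phi> s - \<phi> t\<bar> \<le> e)"
    by (intro eventually_conj eventually_gt_at_top eventually_mesh_oscillation cont \<open>0 < e\<close>)
  then show ?thesis
  proof (eventually_elim, elim conjE, intro allI impI)
    fix n k assume "0 < n" and k: "k \<le> n * R"
      and osc: "\<forall>s\<in>{0..real R}. \<forall>t\<in>{0..real R}. \<bar>s - t\<bar> \<le> 1 / real n \<longrightarrow> \<bar>\<phi> s - \<phi> t\<bar> \<le> e"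
    define \<tau> where "\<tau> k = real k / real n" for k
    have \<tau>: "0 \<le> \<tau> j" "\<tau> j \<le> \<tau> (Suc j)" "\<tau> (Suc j) - \<tau> j = 1 / real n" for j
      using \<open>0 < n\<close> by (auto simp: \<tau>_def divide_right_mono diff_divide_distrib[symmetric])
    have near: "\<bar>\<phi> v - \<phi> (\<tau> (Suc j))\<bar> \<le> e" if "j < n * R" "v \<in> {\<tau> j..\<tau> (Suc j)}" for j v
    proof -
      have "\<tau> (Suc j) \<in> {0..real R}" using that mesh_mem[OF \<open>0 < n\<close>, of "Suc j" R] by (simp add: \<tau>_def)
      moreover have "v \<in> {0..real R}" using that \<tau>[of j] calculation by auto
      moreover have "\<bar>v - \<tau> (Suc j)\<bar> \<le> 1 / real n" using that \<tau>(3)[of j] by auto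
      ultimately show ?thesis using osc by blast
    qed
    have "\<bar>reflected_walk c 0 (increments w n) k - \<phi> (\<tau> k)\<bar> \<le> e"
    proof (rule reflected_walk_close[where m = "n * R" and l = "\<lambda>j. l (\<tau> (Suc j)) - l (\<tau> j)"
          and u = "\<lambda>j. u (\<tau> (Suc j)) - u (\<tau> j)"])
      fix j
      show "\<phi> (\<tau> (Suc j)) = \<phi> (\<tau> j) + increments w n j + (l (\<tau> (Suc j)) - l (\<tau> j)) - (u (\<tau> (Suc j)) - u (\<tau> j))"
        using eq \<tau>(1) by (simp add: increments_def \<tau>_def)
      show "0 \<le> l (\<tau> (Suc j)) - l (\<tau> j)" "0 \<le> u (\<tau> (Suc j)) - u (\<tau> j)"
        using mono \<tau>[of j] by auto
      assume j: "j < n * R"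
      show "\<phi> (\<tau> (Suc j)) \<le> e" if "0 < l (\<tau> (Suc j)) - l (\<tau> j)"
      proof -
        have "\<not> (\<forall>v\<in>{\<tau> j..\<tau> (Suc j)}. \<phi> v \<noteq> 0)"
          using flat(1)[of "\<tau> j" "\<tau> (Suc j)"] \<tau>[of j] that by auto
        then obtain v where "v \<in> {\<tau> j..\<tau> (Suc j)}" "\<phi> v = 0" by blast
        with near[OF j] show ?thesis by fastforce
      qed
      show "c - e \<le> \<phi> (\<tau> (Suc j))" if "0 < u (\<tau> (Suc j)) - u (\<tau> j)"
      proof -
        have "\<not> (\<forall>v\<in>{\<tau> j..\<tau> (Suc j)}. \<phi> v \<noteq> c)"
          using flat(2)[of "\<tau> j" "\<tau> (Suc j)"] \<tau>[of j] that by auto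
        then obtain v where "v \<in> {\<tau> j..\<tau> (Suc j)}" "\<phi> v = c" by blast
        with near[OF j] show ?thesis by fastforce
      qed
    qed (use assms k mem \<tau>(1) \<open>\<phi> 0 = 0\<close> in \<open>auto simp: \<tau>_def\<close>)
    then show "\<bar>reflected_walk c 0 (increments w n) k - \<phi> (real k / real n)\<bar> \<le> e"
      by (simp add: \<tau>_def)
  qed
qed

lemma floor_mesh:
  assumes "0 < n" "0 \<le> s" "s \<le> real R"
  shows "nat \<lfloor>real n * s\<rfloor> \<le> n * R" "\<bar>real (nat \<lfloor>real n * s\<rfloor>) / real n - s\<bar> \<le> 1 / real n"
    "real (nat \<lfloor>real n * s\<rfloor>) / real n \<in> {0..real R}"
proof -
  have "real n * s \<le> real n * real R" using assms by (intro mult_left_mono) auto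
  then have "\<lfloor>real n * s\<rfloor> \<le> int (n * R)" by (simp add: floor_le_iff)
  then show "nat \<lfloor>real n * s\<rfloor> \<le> n * R" by (simp only: nat_le_iff)
  then show "real (nat \<lfloor>real n * s\<rfloor>) / real n \<in> {0..real R}" by (rule mesh_mem[OF assms(1)])
  have "0 \<le> \<lfloor>real n * s\<rfloor>" using assms by simp
  then have "\<bar>real (nat \<lfloor>real n * s\<rfloor>) - real n * s\<bar> \<le> 1"
    by (simp add: of_nat_nat) linarith
  moreover have "real (nat \<lfloor>real n * s\<rfloor>) / real n - s = (real (nat \<lfloor>real n * s\<rfloor>) - real n * s) / real n"
    using assms(1) by (simp add: field_simps)
  ultimately show "\<bar>real (nat \<lfloor>real n * s\<rfloor>) / real n - s\<bar> \<le> 1 / real n"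
    using assms(1) by (simp add: abs_divide divide_right_mono)
qed

lemma reflected_walk_tendsto:
  assumes "two_sided_reflection c w \<phi>" "0 < c" "0 \<le> t"
  shows "(\<lambda>n. reflected_walk c 0 (increments w n) (nat \<lfloor>real n * t\<rfloor>)) \<longlonglongrightarrow> \<phi> t"
proof (rule metric_LIMSEQ_I)
  fix e :: real assume "0 < e"
  obtain R :: nat where R: "t \<le> real R" using real_arch_simple by blast
  have cont: "continuous_on {0..} \<phi>"
    using assms(1) by (simp add: two_sided_reflection_def cont_paths_def)
  have "\<forall>\<^sub>F n in sequentially. 0 < n \<and>
      (\<forall>s\<in>{0..real R}. \<forall>t\<in>{0..real R}. \<bar>s - t\<bar> \<le> 1 / real n \<longrightarrow> \<bar>\<phi> s - \<phi> t\<bar> \<le> e / 3) \<and>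
      (\<forall>k\<le>n * R. \<bar>reflected_walk c 0 (increments w n) k - \<phi> (real k / real n)\<bar> \<le> e / 3)"
    using \<open>0 < e\<close> by (intro eventually_conj eventually_gt_at_top eventually_mesh_oscillation cont
        reflected_walk_approx[OF assms(1,2)]) auto
  then have "\<forall>\<^sub>F n in sequentially. dist (reflected_walk c 0 (increments w n) (nat \<lfloor>real n * t\<rfloor>)) (\<phi> t) < e"
  proof eventually_elim
    case (elim n)
    define k where "k = nat \<lfloor>real n * t\<rfloor>"
    have "\<bar>\<phi> (real k / real n) - \<phi> t\<bar> \<le> e / 3"
      using elim floor_mesh[of n t R] assms(3) R by (auto simp: k_def)
    moreover have "\<bar>reflected_walk c 0 (increments w n) k - \<phi> (real k / real n)\<bar> \<le> e / 3"
      using elim floor_mesh(1)[of n t R] assms(3) R by (auto simp: k_def)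
    ultimately show ?case using \<open>0 < e\<close> unfolding dist_real_def k_def by linarith
  qed
  then show "\<exists>no. \<forall>n\<ge>no. dist (reflected_walk c 0 (increments w n) (nat \<lfloor>real n * t\<rfloor>)) (\<phi> t) < e"
    by (simp add: eventually_sequentially)
qed

text \<open>Writing a sum over the mesh as an integral allows dominated convergence to compare
  \<open>visits\<close> with \<open>time_below\<close>. On half-open cells the floor equals the cell
  index exactly.\<close>

lemma lborel_integral_step:
  fixes g :: "nat \<Rightarrow> real"
  assumes "0 < n"
  shows "has_bochner_integral lborel
    (\<lambda>s. indicator {0..<real k / real n} s * g (nat \<lfloor>real n * s\<rfloor>)) (\<Sum>i<k. g i / real n)"
proof (induction k)
  case 0
  show ?case using has_bochner_integral_zero[where 'b = real] by simp
next
  case (Suc k)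
  have "has_bochner_integral lborel (\<lambda>s. indicator {real k / real n..<real (Suc k) / real n} s * g k)
      (measure lborel {real k / real n..<real (Suc k) / real n} * g k)"
    by (intro has_bochner_integral_mult_left has_bochner_integral_real_indicator) (auto simp: divide_right_mono)
  moreover have "measure lborel {real k / real n..<real (Suc k) / real n} * g k = g k / real n"
    using assms by (simp add: divide_right_mono diff_divide_distrib[symmetric])
  ultimately have "has_bochner_integral lborel (\<lambda>s. indicator {0..<real k / real n} s * g (nat \<lfloor>real n * s\<rfloor>) +
     indicator {real k / real n..<real (Suc k) / real n} s * g k) ((\<Sum>i<k. g i / real n) + g k / real n)"
    using Suc by (intro has_bochner_integral_add) simp_all
  moreover have "indicator {0..<real k / real n} s * g (nat \<lfloor>real n * s\<rfloor>) +
     indicator {real k / real n..<real (Suc k) / real n} s * g k =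
     indicator {0..<real (Suc k) / real n} s * g (nat \<lfloor>real n * s\<rfloor>)" for s
  proof (cases "real k / real n \<le> s \<and> s < real (Suc k) / real n")
    case True
    then have "real k \<le> real n * s" "real n * s < real k + 1"
      using assms by (simp_all add: field_simps)
    then have "\<lfloor>real n * s\<rfloor> = int k" by (simp add: floor_eq_iff)
    moreover have "0 \<le> s" using True order_trans[of 0 "real k / real n" s] by simp
    ultimately show ?thesis using True by (simp add: indicator_def)
  next
    case False
    moreover have "real k / real n \<le> real (Suc k) / real n" by (simp add: divide_right_mono)
    ultimately show ?thesis by (auto simp: indicator_def)
  qed
  ultimately show ?case by simp
qed

section \<open>Convergence of the censored walk\<close>

text \<open>The assumption \<open>null\<close> is what lets the discrete clock converge: away from
  level \<open>b\<close>, closeness of walk and path decides on which side of \<open>b\<close> both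
  are.\<close>

locale censored_path = clocked_path \<phi> b for \<phi> b +
  fixes a :: real and w :: "real \<Rightarrow> real"
  assumes levels: "0 < b" "b < a" and reflection: "two_sided_reflection a w \<phi>"
    and null: "\<And>t. 0 \<le> t \<Longrightarrow> measure lborel {s \<in> {0..t}. \<phi> s = b} = 0"
begin

abbreviation "X n \<equiv> reflected_walk a 0 (increments w n)"
abbreviation "V n \<equiv> visits a b 0 (increments w n)"
text \<open>The horizon \<open>n * n\<close> corresponds to time \<open>n\<close>, hence it disappears in the limit.\<close>

abbreviation "Z n \<equiv> reflected_walk b 0 (censor a b (n * n) 0 (increments w n))"

lemma AE_not_level: "AE s in lborel. s \<in> {0..t} \<longrightarrow> \<phi> s \<noteq> b"
proof (cases "0 \<le> t")
  case True
  have sets: "{s \<in> {0..t}. \<phi> s \<in> {b}} \<in> sets lborel"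
    by (rule sets_path_preimage(1)[OF path_cont]) auto
  have "emeasure lborel {s \<in> {0..t}. \<phi> s \<in> {b}} \<le> emeasure lborel {0..t}"
    by (rule emeasure_mono) auto
  also have "\<dots> < \<infinity>" using True by simp
  finally have "emeasure lborel {s \<in> {0..t}. \<phi> s \<in> {b}} = 0"
    using null[OF True] by (simp add: emeasure_eq_ennreal_measure)
  then have "{s \<in> {0..t}. \<phi> s \<in> {b}} \<in> null_sets lborel" using sets by auto
  from AE_not_in[OF this] show ?thesis by eventually_elim auto
qed simp

lemma visits_eq_integral:
  assumes "0 < n" "k \<le> n * R"
  shows "real (V n k) / real n =
    (LINT s|lborel. indicator {0..<real k / real n} s * (if X n (nat \<lfloor>real n * s\<rfloor>) \<le> b then 1 else 0))"
proof -
  have "real (V n k) = (\<Sum>i<k. if X n i \<le> b then 1 else 0)" for k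
    by (induction k) (simp_all add: visits_Suc)
  then have "real (V n k) / real n = (\<Sum>i<k. (if X n i \<le> b then 1 else 0) / real n)"
    by (simp add: sum_divide_distrib)
  then show ?thesis
    using has_bochner_integral_integral_eq[OF lborel_integral_step[OF assms(1), of k "\<lambda>i. if X n i \<le> b then 1 else 0"]]
    by simp
qed

lemma time_below_eq_integral:
  "A t = (LINT s|lborel. indicator {0..<t} s * (if \<phi> s \<le> b then 1 else 0))"
proof -
  have "A t = measure lborel ({s \<in> {0..t}. \<phi> s \<in> {..b}} - {t})"
    unfolding time_below_eq
    by (intro measure_Diff_null_set[symmetric] sets_path_preimage(1)[OF path_cont]) auto
  also have "\<dots> = (LINT s|lborel. indicator ({s \<in> {0..t}. \<phi> s \<in> {..b}} - {t}) s)"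
    by simp
  also have "\<dots> = (LINT s|lborel. indicator {0..<t} s * (if \<phi> s \<le> b then 1 else 0))"
    by (intro Bochner_Integration.integral_cong) (auto simp: indicator_def)
  finally show ?thesis .
qed

lemma step_measurable [measurable]:
  fixes g :: "nat \<Rightarrow> real"
  shows "(\<lambda>s. g (nat \<lfloor>real n * s\<rfloor>)) \<in> borel_measurable lborel"
  by measurable

lemma below_measurable:
  assumes "S \<subseteq> {0..t}" "S \<in> sets borel"
  shows "(\<lambda>s. indicator S s * (if \<phi> s \<le> b then 1 else (0::real))) \<in> borel_measurable lborel"
proof -
  have "(\<lambda>s. indicator S s * (if \<phi> s \<le> b then 1 else (0::real))) =
      indicator (S \<inter> {s \<in> {0..t}. \<phi> s \<in> {..b}})"
    using assms(1) by (auto simp: indicator_def fun_eq_iff)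
  moreover have "S \<inter> {s \<in> {0..t}. \<phi> s \<in> {..b}} \<in> sets lborel"
    by (rule sets.Int, use assms(2) in simp, rule sets_path_preimage(1)[OF path_cont]) auto
  ultimately show ?thesis
    by (simp only: borel_measurable_indicator)
qed

text \<open>At every time with \<open>\<phi> s \<noteq> b\<close> the two indicators agree for all
  large \<open>n\<close>; the remaining times form a null set.\<close>

lemma step_error_tendsto:
  "(\<lambda>n. LINT s|lborel. indicator {0..real R} s *
     \<bar>(if X n (nat \<lfloor>real n * s\<rfloor>) \<le> b then 1 else 0) - (if \<phi> s \<le> b then 1 else (0::real))\<bar>) \<longlonglongrightarrow> 0"
proof -
  define g where "g n s = indicator {0..real R} s *
      \<bar>(if X n (nat \<lfloor>real n * s\<rfloor>) \<le> b then 1 else 0) - (if \<phi> s \<le> b then 1 else (0::real))\<bar>" for n s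
  have "(\<lambda>n. LINT s|lborel. g n s) \<longlonglongrightarrow> (LINT s::real|lborel. (0::real))"
  proof (rule Bochner_Integration.integral_dominated_convergence[where w = "indicator {0..real R}" and s = g and f = "\<lambda>_. 0"])
    fix n
    have "g n = (\<lambda>s. \<bar>indicator {0..real R} s * (if X n (nat \<lfloor>real n * s\<rfloor>) \<le> b then 1 else 0) -
        indicator {0..real R} s * (if \<phi> s \<le> b then 1 else 0)\<bar>)"
      by (auto simp: g_def fun_eq_iff indicator_def)
    moreover have "(\<lambda>s. indicator {0..real R} s * (if X n (nat \<lfloor>real n * s\<rfloor>) \<le> b then 1 else (0::real)))
        \<in> borel_measurable lborel"
      by measurable
    moreover have "(\<lambda>s. indicator {0..real R} s * (if \<phi> s \<le> b then 1 else (0::real))) \<in> borel_measurable lborel"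
      by (rule below_measurable) auto
    ultimately show "g n \<in> borel_measurable lborel"
      by (simp only: borel_measurable_abs borel_measurable_diff)
    show "AE s in lborel. norm (g n s) \<le> indicator {0..real R} s"
      by (auto simp: g_def indicator_def)
  next
    show "AE s in lborel. (\<lambda>n. g n s) \<longlonglongrightarrow> 0"
      using AE_not_level[of "real R"]
    proof eventually_elim
      case (elim s)
      show ?case
      proof (cases "s \<in> {0..real R}")
        case True
        have lim: "(\<lambda>n. X n (nat \<lfloor>real n * s\<rfloor>)) \<longlonglongrightarrow> \<phi> s"
          using True levels by (intro reflected_walk_tendsto[OF reflection]) auto
        have "\<forall>\<^sub>F n in sequentially. X n (nat \<lfloor>real n * s\<rfloor>) \<le> b \<longleftrightarrow> \<phi> s \<le> b"
        proof (cases "\<phi> s < b")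
          case True
          from order_tendstoD(2)[OF lim True] show ?thesis
            by eventually_elim (use True in auto)
        next
          case False
          then have "b < \<phi> s" using elim \<open>s \<in> _\<close> by auto
          from order_tendstoD(1)[OF lim this] show ?thesis
            by eventually_elim (use \<open>b < \<phi> s\<close> in auto)
        qed
        then have "\<forall>\<^sub>F n in sequentially. g n s = 0"
          by eventually_elim (simp add: g_def)
        then show ?thesis by (rule tendsto_eventually)
      qed (simp add: g_def)
    qed
  qed simp_all
  then show ?thesis by (simp add: g_def)
qed

text \<open>Uniformity in \<open>k\<close> is free: the error over the whole of
  \<open>{0..real R}\<close> dominates the error up to each mesh point.\<close>

lemma eventually_visits_close:
  assumes "0 < e"
  shows "\<forall>\<^sub>F n in sequentially. \<forall>k\<le>n * R. \<bar>real (V n k) / real n - A (real k / real n)\<bar> \<le> e"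
proof -
  define f where "f n s = (if X n (nat \<lfloor>real n * s\<rfloor>) \<le> b then 1 else 0 :: real)" for n s
  define f0 where "f0 s = (if \<phi> s \<le> b then 1 else 0 :: real)" for s
  have "\<forall>\<^sub>F n in sequentially. 0 < n \<and> (LINT s|lborel. indicator {0..real R} s * \<bar>f n s - f0 s\<bar>) < e"
    using order_tendstoD(2)[OF step_error_tendsto assms, of R]
    by (intro eventually_conj eventually_gt_at_top) (simp add: f_def f0_def)
  then show ?thesis
  proof (eventually_elim, elim conjE, intro allI impI)
    fix n k assume n: "0 < n" and k: "k \<le> n * R"
      and err: "(LINT s|lborel. indicator {0..real R} s * \<bar>f n s - f0 s\<bar>) < e"
    let ?k = "real k / real n"
    have sub: "{0..<?k} \<subseteq> {0..real R}" using mesh_mem[OF n k] by auto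
    have dom: "integrable lborel (\<lambda>s. indicator S s * f n s)" "integrable lborel (\<lambda>s. indicator S s * f0 s)"
      "integrable lborel (\<lambda>s. indicator S s * \<bar>f n s - f0 s\<bar>)"
      if S: "S \<subseteq> {0..real R}" "S \<in> sets borel" for S
    proof -
      have S_int: "integrable lborel (indicator {0..real R} :: real \<Rightarrow> real)" by simp
      have m: "(\<lambda>s. indicator S s * f n s) \<in> borel_measurable lborel"
        unfolding f_def using S(2) by measurable
      have m0: "(\<lambda>s. indicator S s * f0 s) \<in> borel_measurable lborel"
        unfolding f0_def by (rule below_measurable[OF S])
      show f_int: "integrable lborel (\<lambda>s. indicator S s * f n s)"
        by (rule Bochner_Integration.integrable_bound[OF S_int m], rule always_eventually)
          (use S(1) in \<open>auto simp: f_def indicator_def\<close>)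
      show f0_int: "integrable lborel (\<lambda>s. indicator S s * f0 s)"
        by (rule Bochner_Integration.integrable_bound[OF S_int m0], rule always_eventually)
          (use S(1) in \<open>auto simp: f0_def indicator_def\<close>)
      from f_int f0_int have "integrable lborel (\<lambda>s. \<bar>indicator S s * f n s - indicator S s * f0 s\<bar>)"
        by (intro integrable_abs Bochner_Integration.integrable_diff)
      moreover have "\<bar>indicator S s * f n s - indicator S s * f0 s\<bar> = indicator S s * \<bar>f n s - f0 s\<bar>" for s
        by (simp add: indicator_def)
      ultimately show "integrable lborel (\<lambda>s. indicator S s * \<bar>f n s - f0 s\<bar>)" by simp
    qed
    define F F0 where "F s = indicator {0..<?k} s * f n s" and "F0 s = indicator {0..<?k} s * f0 s" for s
    define G where "G s = indicator {0..real R} s * \<bar>f n s - f0 s\<bar>" for s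
    have F: "integrable lborel F" and F0: "integrable lborel F0" and G: "integrable lborel G"
      unfolding F_def F0_def G_def by (rule dom, use sub in simp, simp)+
    have FG: "\<bar>F s - F0 s\<bar> \<le> G s" for s
    proof (cases "s \<in> {0..<?k}")
      case True
      then have "s \<in> {0..real R}" using sub by blast
      with True show ?thesis by (simp only: F_def F0_def G_def indicator_simps mult_1)
    next
      case False
      then have "F s = 0" "F0 s = 0" by (simp_all only: F_def F0_def indicator_simps mult_zero_left simp_thms)
      then show ?thesis by (simp add: G_def)
    qed
    have "real (V n k) / real n - A ?k = (LINT s|lborel. F s) - (LINT s|lborel. F0 s)"
      unfolding F_def F0_def f_def f0_def visits_eq_integral[OF n k] time_below_eq_integral ..
    also have "\<dots> = (LINT s|lborel. F s - F0 s)"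
      by (rule Bochner_Integration.integral_diff[OF F F0, symmetric])
    also have "\<bar>\<dots>\<bar> \<le> (LINT s|lborel. \<bar>F s - F0 s\<bar>)"
      by (rule integral_abs_bound)
    also have "\<dots> \<le> (LINT s|lborel. G s)"
      by (intro integral_mono integrable_abs Bochner_Integration.integrable_diff F F0 G FG)
    also have "\<dots> < e" using err by (simp only: G_def)
    finally show "\<bar>real (V n k) / real n - A ?k\<bar> \<le> e" by (rule less_imp_le)
  qed
qed

text \<open>A step of the walk is at most \<open>3 * e\<close>: \<open>e\<close> from the
  oscillation of \<phi> and \<open>e\<close> from the approximation at either end. The condition
  \<open>R \<le> n\<close> keeps indices up to \<open>n * R\<close> before the horizon
  \<open>n * n\<close>.\<close>

lemma eventually_grid_close:
  assumes "0 < e"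
  shows "\<forall>\<^sub>F n in sequentially. 0 < n \<and> R \<le> n \<and>
    (\<forall>s\<in>{0..real R}. \<forall>t\<in>{0..real R}. \<bar>s - t\<bar> \<le> 1 / real n \<longrightarrow> \<bar>\<phi> s - \<phi> t\<bar> \<le> e) \<and>
    (\<forall>k\<le>n * R. \<bar>X n k - \<phi> (real k / real n)\<bar> \<le> e \<and>
      \<bar>real (V n k) / real n - A (real k / real n)\<bar> \<le> e \<and>
      (if X n k \<le> b then \<bar>X n k - Z n (V n k)\<bar> \<le> 3 * e else b - 3 * e \<le> Z n (V n k)))"
proof -
  have "\<forall>\<^sub>F n in sequentially. 0 < n \<and> R \<le> n \<and>
      (\<forall>s\<in>{0..real R}. \<forall>t\<in>{0..real R}. \<bar>s - t\<bar> \<le> 1 / real n \<longrightarrow> \<bar>\<phi> s - \<phi> t\<bar> \<le> e) \<and>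
      (\<forall>k\<le>n * R. \<bar>X n k - \<phi> (real k / real n)\<bar> \<le> e) \<and>
      (\<forall>k\<le>n * R. \<bar>real (V n k) / real n - A (real k / real n)\<bar> \<le> e)"
    using levels assms
    by (intro eventually_conj eventually_gt_at_top eventually_ge_at_top eventually_mesh_oscillation
        path_cont reflected_walk_approx[OF reflection] eventually_visits_close) auto
  then show ?thesis
  proof eventually_elim
    case (elim n)
    have "if X n k \<le> b then \<bar>X n k - Z n (V n k)\<bar> \<le> 3 * e else b - 3 * e \<le> Z n (V n k)"
      if k: "k \<le> n * R" for k
    proof (rule censored_walk_close)
      show "k \<le> n * n" using k elim by (meson le_trans mult_le_mono2)
      fix i assume i: "i < k"
      have "\<bar>\<phi> (real (Suc i) / real n) - \<phi> (real i / real n)\<bar> \<le> e"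
      proof -
        have "real (Suc i) / real n \<in> {0..real R}" "real i / real n \<in> {0..real R}"
          using i k elim by (intro mesh_mem; simp)+
        moreover have "\<bar>real (Suc i) / real n - real i / real n\<bar> \<le> 1 / real n"
          by (simp add: diff_divide_distrib[symmetric])
        ultimately show ?thesis using elim by blast
      qed
      moreover have "\<bar>X n (Suc i) - \<phi> (real (Suc i) / real n)\<bar> \<le> e" "\<bar>X n i - \<phi> (real i / real n)\<bar> \<le> e"
        using elim i k by (simp_all del: reflected_walk.simps of_nat_Suc)
      ultimately show "\<bar>X n (Suc i) - X n i\<bar> \<le> 3 * e" by linarith
    qed (use levels assms in auto)
    with elim show ?case by blast
  qed
qed

text \<open>The discrete inverse clock: \<open>V n\<close> rises by one exactly at kept indices, so
  it passes through each value below \<open>V n m\<close> at one of them.\<close>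

lemma walk_index:
  assumes "j < V n m"
  obtains k where "k < m" "V n k = j" "X n k \<le> b"
  using assms
proof (induction m arbitrary: thesis)
  case (Suc m)
  show ?case
  proof (cases "j < V n m")
    case True
    then show ?thesis using Suc.IH[of thesis] Suc.prems(1) less_SucI by blast
  next
    case False
    then have "V n m = j" "X n m \<le> b"
      using Suc.prems(2) by (auto simp: visits_Suc split: if_splits)
    then show ?thesis using Suc.prems(1)[of m] by simp
  qed
qed simp

text \<open>The kept walk at its own step \<open>J n\<close> is compared with \<phi> at the mesh
  time \<open>s n\<close> of the kept increment filed in that slot. The clock at \<open>s n\<close>
  tends to \<open>t\<close>, and \<open>tendsto_path_proj\<close> absorbs the possible
  non-convergence of \<open>s n\<close>.\<close>

lemma censored_walk_tendsto:
  assumes "0 \<le> t" and reached: "\<exists>r\<ge>0. t < A r"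
  shows "(\<lambda>n. Z n (nat \<lfloor>real n * t\<rfloor>)) \<longlonglongrightarrow> path_proj b \<phi> t"
proof -
  obtain r where r: "0 \<le> r" "t < A r" using reached by blast
  obtain R :: nat where R: "r \<le> real R" using real_arch_simple by blast
  \<comment> \<open>Half of the excess of the clock over \<open>t\<close>, so that the discrete
    clock at index \<open>n * R\<close> still exceeds \<open>t\<close> and slot \<open>J n\<close>
    is filled before it.\<close>
  define \<eta> where "\<eta> = (A R - t) / 2"
  have "t < A R" using r R time_below_mono[of r R] by simp
  then have \<eta>: "0 < \<eta>" "t < A R - \<eta>" by (simp_all add: \<eta>_def field_simps)
  define J where "J n = nat \<lfloor>real n * t\<rfloor>" for n
  have J: "real (J n) \<le> real n * t" for n
    unfolding J_def using assms(1) by simp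
  define Q where "Q n k \<longleftrightarrow> k < n * R \<and> V n k = J n \<and> X n k \<le> b" for n k
  have ex: "\<forall>\<^sub>F n in sequentially. \<exists>k. Q n k"
    using eventually_grid_close[OF \<eta>(1), of R]
  proof eventually_elim
    case (elim n)
    then have "A (real (n * R) / real n) - \<eta> \<le> real (V n (n * R)) / real n"
      by (auto simp: abs_le_iff)
    then have "t < real (V n (n * R)) / real n" using \<eta>(2) elim by simp
    then have "real n * t < real (V n (n * R))" using elim by (simp add: field_simps)
    then have "J n < V n (n * R)" using J[of n] by linarith
    then show ?case unfolding Q_def by (metis walk_index)
  qed
  define K where "K n = (SOME k. Q n k)" for n
  have K: "\<forall>\<^sub>F n in sequentially. Q n (K n)"
    using ex by eventually_elim (auto simp: K_def intro: someI_ex)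
  define s where "s n = real (K n) / real n" for n
  have close: "\<forall>\<^sub>F n in sequentially. s n \<in> {0..real R} \<and> \<bar>X n (K n) - \<phi> (s n)\<bar> \<le> e \<and>
      \<bar>real (J n) / real n - A (s n)\<bar> \<le> e \<and> \<bar>X n (K n) - Z n (J n)\<bar> \<le> 3 * e \<and> X n (K n) \<le> b"
    if "0 < e" for e
    using K eventually_grid_close[OF that, of R]
  proof eventually_elim
    case (elim n)
    then have "K n \<le> n * R" "V n (K n) = J n" "X n (K n) \<le> b" by (auto simp: Q_def)
    with elim show ?case using mesh_mem[of n "K n" R] unfolding s_def by metis
  qed
  have "(\<lambda>n. real (J n) / real n) \<longlonglongrightarrow> t"
  proof (rule real_tendsto_sandwich[of "\<lambda>n. t - 1 / real n" _ _ "\<lambda>n. t"])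
    show "\<forall>\<^sub>F n in sequentially. real (J n) / real n \<le> t"
      using eventually_gt_at_top[of 0] by eventually_elim (use J in \<open>simp add: field_simps\<close>)
    have J': "real n * t - 1 \<le> real (J n)" for n unfolding J_def by linarith
    show "\<forall>\<^sub>F n in sequentially. t - 1 / real n \<le> real (J n) / real n"
      using eventually_gt_at_top[of 0] 
    proof eventually_elim
      case (elim n)
      then have "(real n * t - 1) / real n \<le> real (J n) / real n" using J' by (intro divide_right_mono) auto
      then show ?case using elim by (simp add: diff_divide_distrib)
    qed
    show "(\<lambda>n. t - 1 / real n) \<longlonglongrightarrow> t"
      using tendsto_diff[OF tendsto_const lim_1_over_n, of t] by simp
  qed simp
  moreover have "(\<lambda>n. real (J n) / real n - A (s n)) \<longlonglongrightarrow> 0"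
  proof (rule tendstoI)
    fix e :: real assume "0 < e"
    then show "\<forall>\<^sub>F n in sequentially. dist (real (J n) / real n - A (s n)) 0 < e"
      using close[of "e / 2"] by (auto elim!: eventually_mono)
  qed
  ultimately have "(\<lambda>n. real (J n) / real n - (real (J n) / real n - A (s n))) \<longlonglongrightarrow> t - 0"
    by (rule tendsto_diff)
  then have "(\<lambda>n. A (s n)) \<longlonglongrightarrow> t" by simp
  moreover have "\<forall>\<^sub>F n in sequentially. s n \<in> {0..real R}"
    using close[of 1] by (auto elim!: eventually_mono)
  moreover have "\<forall>\<^sub>F n in sequentially. \<phi> (s n) \<le> b + e" if "0 < e" for e
    using close[OF that] by (auto elim!: eventually_mono simp: abs_le_iff)
  ultimately have "(\<lambda>n. \<phi> (s n)) \<longlonglongrightarrow> path_proj b \<phi> t"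
    using assms by (intro tendsto_path_proj)
  moreover have "(\<lambda>n. Z n (J n) - \<phi> (s n)) \<longlonglongrightarrow> 0"
  proof (rule tendstoI)
    fix e :: real assume e: "0 < e"
    \<comment> \<open>Three parts between kept walk and walk, one between walk and path, and one
      spare for the strict inequality.\<close>
    then have "0 < e / 5" by simp
    from close[OF this] show "\<forall>\<^sub>F n in sequentially. dist (Z n (J n) - \<phi> (s n)) 0 < e"
    proof eventually_elim
      case (elim n)
      then have "\<bar>Z n (J n) - \<phi> (s n)\<bar> \<le> 4 * (e / 5)" by linarith
      then show ?case using e by simp
    qed
  qed
  ultimately have "(\<lambda>n. \<phi> (s n) + (Z n (J n) - \<phi> (s n))) \<longlonglongrightarrow> path_proj b \<phi> t + 0"
    by (rule tendsto_add)
  then show ?thesis by (simp add: J_def)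
qed

text \<open>A passage of \<phi> from 0 to above \<open>b\<close> that costs little clock time
  appears in the kept walk as a large rise in few steps.\<close>

lemma censored_walk_oscillates:
  assumes s: "0 \<le> s" "s < s'" "\<phi> s = 0" "b < \<phi> s'" and clock: "A s' - A s < h" "A s' \<le> real T"
  shows "\<forall>\<^sub>F n in sequentially. \<exists>i j. i \<le> j \<and> j \<le> n * Suc T \<and> real (j - i) \<le> h * real n \<and> b / 2 \<le> Z n j - Z n i"
proof -
  obtain R :: nat where R: "s' \<le> real R" using real_arch_simple by blast
  \<comment> \<open>The four bounds keep the walk above \<open>b\<close> near \<open>s'\<close>,
    make the rise at least \<open>b - 8 * e\<close>, hence \<open>b / 2\<close>, keep the number of
    steps within \<open>h * n\<close>, and keep the last index within
    \<open>n * Suc T\<close>.\<close>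
  define e where "e = Min {(\<phi> s' - b) / 4, b / 16, (h - (A s' - A s)) / 4, 1 / 2}"
  have "0 < e" using s clock levels by (simp add: e_def)
  have "e \<le> (\<phi> s' - b) / 4" "e \<le> b / 16" "e \<le> (h - (A s' - A s)) / 4" "e \<le> 1 / 2"
    unfolding e_def by (rule Min_le; simp)+
  then have e: "4 * e \<le> \<phi> s' - b" "16 * e \<le> b" "4 * e \<le> h - (A s' - A s)" "2 * e \<le> 1" by simp_all
  have "\<forall>\<^sub>F n in sequentially. 1 / real n < e"
    by (rule order_tendstoD(2)[OF lim_1_over_n \<open>0 < e\<close>])
  then show ?thesis using eventually_grid_close[OF \<open>0 < e\<close>, of R]
  proof eventually_elim
    case (elim n)
    then have n: "0 < n" "1 / real n < e" by auto
    have at: "\<bar>X n (nat \<lfloor>real n * v\<rfloor>) - \<phi> v\<bar> \<le> 2 * e"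
      "\<bar>real (V n (nat \<lfloor>real n * v\<rfloor>)) / real n - A v\<bar> \<le> 2 * e"
      if v: "0 \<le> v" "v \<le> real R" for v
    proof -
      note fl = floor_mesh[OF n(1) v]
      have "\<bar>\<phi> (real (nat \<lfloor>real n * v\<rfloor>) / real n) - \<phi> v\<bar> \<le> e"
        using elim fl v by auto
      moreover have "\<bar>X n (nat \<lfloor>real n * v\<rfloor>) - \<phi> (real (nat \<lfloor>real n * v\<rfloor>) / real n)\<bar> \<le> e"
        using elim fl(1) by blast
      ultimately show "\<bar>X n (nat \<lfloor>real n * v\<rfloor>) - \<phi> v\<bar> \<le> 2 * e" by linarith
      have "\<bar>A (real (nat \<lfloor>real n * v\<rfloor>) / real n) - A v\<bar> \<le> e"
        using time_below_lipschitz[of v "real (nat \<lfloor>real n * v\<rfloor>) / real n"] fl(2) n v by simp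
      moreover have "\<bar>real (V n (nat \<lfloor>real n * v\<rfloor>)) / real n - A (real (nat \<lfloor>real n * v\<rfloor>) / real n)\<bar> \<le> e"
        using elim fl(1) by blast
      ultimately show "\<bar>real (V n (nat \<lfloor>real n * v\<rfloor>)) / real n - A v\<bar> \<le> 2 * e" by linarith
    qed
    define k k' where "k = nat \<lfloor>real n * s\<rfloor>" and "k' = nat \<lfloor>real n * s'\<rfloor>"
    have k_le: "k \<le> n * R" "k' \<le> n * R"
      using floor_mesh(1)[OF n(1), of s R] floor_mesh(1)[OF n(1), of s' R] s R by (auto simp: k_def k'_def)
    have "k \<le> k'" unfolding k_def k'_def using s by (intro nat_mono floor_mono mult_left_mono) auto
    have X: "\<bar>X n k\<bar> \<le> 2 * e" "\<bar>X n k' - \<phi> s'\<bar> \<le> 2 * e"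
      using at(1)[of s] at(1)[of s'] s R by (auto simp: k_def k'_def)
    then have "X n k \<le> b" "\<not> X n k' \<le> b" using e \<open>0 < e\<close> by linarith+
    then have "\<bar>X n k - Z n (V n k)\<bar> \<le> 3 * e" "b - 3 * e \<le> Z n (V n k')"
      using elim k_le by presburger+
    then have gap: "b / 2 \<le> Z n (V n k') - Z n (V n k)" using X e by linarith
    have VA: "\<bar>real (V n k) / real n - A s\<bar> \<le> 2 * e" "\<bar>real (V n k') / real n - A s'\<bar> \<le> 2 * e"
      using at(2)[of s] at(2)[of s'] s R by (auto simp: k_def k'_def)
    have mono: "V n k \<le> V n k'" by (rule visits_mono) fact
    have le: "V n k' \<le> n * Suc T"
    proof -
      have "real (V n k') / real n \<le> real (Suc T)" using VA clock e by simp
      then have "real (V n k') \<le> real (n * Suc T)" using n by (simp add: field_simps)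
      then show ?thesis by (simp only: of_nat_le_iff)
    qed
    have "real (V n k' - V n k) \<le> h * real n"
    proof -
      have "(real (V n k') - real (V n k)) / real n \<le> h"
        using VA e unfolding diff_divide_distrib by linarith
      then have "real (V n k') - real (V n k) \<le> h * real n" using n by (simp only: pos_divide_le_eq of_nat_0_less_iff)
      then show ?thesis using mono by (simp only: of_nat_diff)
    qed
    with gap mono le show ?case by blast
  qed
qed

end

section \<open>Laws of increments and of processes\<close>

abbreviation real_seqs :: "(nat \<Rightarrow> real) measure" where
  "real_seqs \<equiv> \<Pi>\<^sub>M i\<in>UNIV. borel"

definition increment_law :: "real \<Rightarrow> nat \<Rightarrow> real measure" where
  "increment_law \<theta> n =
     distr (density lborel (normal_density 0 (sqrt (1 / real n)))) borel (\<lambda>x. x - 2 * \<theta> / real n)"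

lemma sets_increment_law [measurable_cong]: "sets (increment_law \<theta> n) = sets borel"
  by (simp add: increment_law_def)

lemma sets_PiM_increment_law:
  "sets (\<Pi>\<^sub>M i\<in>UNIV. increment_law \<theta> n) = sets real_seqs"
  by (rule sets_PiM_cong) (auto simp: increment_law_def)

lemma prob_space_increment_law: "0 < n \<Longrightarrow> prob_space (increment_law \<theta> n)"
  unfolding increment_law_def
  by (intro prob_space.prob_space_distr prob_space_normal_density) simp_all

lemma (in prob_space) indep_vars_nat_all:
  fixes X :: "nat \<Rightarrow> 'a \<Rightarrow> 'b"
  assumes "\<And>n. indep_vars M' X {..<n}"
  shows "indep_vars M' X UNIV"
  unfolding indep_vars_def2
proof
  show "\<forall>i\<in>UNIV. random_variable (M' i) (X i)"
    using assms unfolding indep_vars_def2 by (metis lessThan_iff lessI)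
  show "indep_sets (\<lambda>i. {X i -` A \<inter> space M |A. A \<in> sets (M' i)}) UNIV"
  proof (subst indep_sets_finite_index_sets, intro allI impI)
    fix J :: "nat set" assume "finite J"
    then obtain n where "J \<subseteq> {..<n}" by (auto simp: finite_nat_iff_bounded)
    from indep_vars_subset[OF assms this]
    show "indep_sets (\<lambda>i. {X i -` A \<inter> space M |A. A \<in> sets (M' i)}) J"
      by (simp add: indep_vars_def2)
  qed
qed

definition drifted :: "real \<Rightarrow> (real \<Rightarrow> 'w \<Rightarrow> real) \<Rightarrow> 'w \<Rightarrow> real \<Rightarrow> real" where
  "drifted \<theta> \<beta> \<omega> t = \<beta> t \<omega> - 2 * \<theta> * t"

lemma standard_brownian_motionD:
  assumes "standard_brownian_motion M \<beta>"
  shows "prob_space M" "0 \<le> t \<Longrightarrow> \<beta> t \<in> borel_measurable M"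
    and "0 \<le> s \<Longrightarrow> s < t \<Longrightarrow> distributed M lborel (\<lambda>\<omega>. \<beta> t \<omega> - \<beta> s \<omega>)
      (\<lambda>x. ennreal (normal_density 0 (sqrt (t - s)) x))"
    and "0 \<le> \<tau> 0 \<Longrightarrow> mono \<tau> \<Longrightarrow> prob_space.indep_vars M (\<lambda>_. borel)
      (\<lambda>i \<omega>. \<beta> (\<tau> (Suc i)) \<omega> - \<beta> (\<tau> i) \<omega>) {..<m}"
  using assms unfolding standard_brownian_motion_def by blast+

lemma measurable_increments_drifted:
  assumes "standard_brownian_motion M \<beta>"
  shows "(\<lambda>\<omega>. increments (drifted \<theta> \<beta> \<omega>) n) \<in> M \<rightarrow>\<^sub>M real_seqs"
proof (rule measurable_PiM_single')
  fix i :: nat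
  have [measurable]: "\<beta> t \<in> borel_measurable M" if "0 \<le> t" for t
    using standard_brownian_motionD(2)[OF assms that] .
  have [measurable]: "\<beta> (real i / real n) \<in> borel_measurable M" "\<beta> (real (Suc i) / real n) \<in> borel_measurable M"
    by measurable
  show "(\<lambda>\<omega>. increments (drifted \<theta> \<beta> \<omega>) n i) \<in> borel_measurable M"
    unfolding increments_def drifted_def by measurable
qed auto

text \<open>Independence and Gaussian law of the driving motion enter through this product
  measure.\<close>

lemma distr_increments_drifted:
  assumes B: "standard_brownian_motion M \<beta>" and "0 < n"
  shows "distr M real_seqs (\<lambda>\<omega>. increments (drifted \<theta> \<beta> \<omega>) n) = (\<Pi>\<^sub>M i\<in>UNIV. increment_law \<theta> n)"
proof -
  have *: "0 \<le> real i / real n" "real i / real n < real (Suc i) / real n"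
    "real (Suc i) / real n - real i / real n = 1 / real n" for i
    using \<open>0 < n\<close> by (auto simp: divide_strict_right_mono diff_divide_distrib[symmetric])
  interpret prob_space M using B by (rule standard_brownian_motionD)
  have m [measurable]: "\<beta> (real i / real n) \<in> borel_measurable M" for i
    using standard_brownian_motionD(2)[OF B *(1)] .
  define D where "D i \<omega> = \<beta> (real (Suc i) / real n) \<omega> - \<beta> (real i / real n) \<omega>" for i \<omega>
  have D [measurable]: "D i \<in> borel_measurable M" for i
    unfolding D_def by (intro borel_measurable_diff m)
  have incr: "increments (drifted \<theta> \<beta> \<omega>) n i = D i \<omega> - 2 * \<theta> / real n" for i \<omega>
  proof -
    have "2 * \<theta> * (real (Suc i) / real n) - 2 * \<theta> * (real i / real n) = 2 * \<theta> / real n"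
      unfolding right_diff_distrib[symmetric] *(3) by simp
    then show ?thesis by (simp add: increments_def drifted_def D_def del: of_nat_Suc)
  qed
  have "mono (\<lambda>i. real i / real n)" by (intro monoI divide_right_mono) auto
  from standard_brownian_motionD(4)[OF B *(1)[of 0] this] have "indep_vars (\<lambda>_. borel) D {..<m}" for m
    unfolding D_def .
  then have "indep_vars (\<lambda>_. borel) D UNIV" by (rule indep_vars_nat_all)
  then have "indep_vars (\<lambda>_. borel) (\<lambda>i \<omega>. D i \<omega> - 2 * \<theta> / real n) UNIV"
    by (rule indep_vars_compose2) measurable
  moreover have "(\<lambda>\<omega>. D i \<omega> - 2 * \<theta> / real n) \<in> borel_measurable M" for i by measurable
  ultimately have "distr M real_seqs (\<lambda>\<omega>. \<lambda>i\<in>UNIV. D i \<omega> - 2 * \<theta> / real n) =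
      (\<Pi>\<^sub>M i\<in>UNIV. distr M borel (\<lambda>\<omega>. D i \<omega> - 2 * \<theta> / real n))"
    by (subst (asm) indep_vars_iff_distr_eq_PiM) auto
  moreover have "distr M borel (\<lambda>\<omega>. D i \<omega> - 2 * \<theta> / real n) = increment_law \<theta> n" for i
  proof -
    have "distributed M lborel (D i) (\<lambda>x. ennreal (normal_density 0 (sqrt (1 / real n)) x))"
      using standard_brownian_motionD(3)[OF B *(1,2)[of i]] unfolding D_def *(3) .
    then have "distr M lborel (D i) = density lborel (normal_density 0 (sqrt (1 / real n)))"
      by (rule distributed_distr_eq_density)
    then have "increment_law \<theta> n = distr (distr M lborel (D i)) borel (\<lambda>x. x - 2 * \<theta> / real n)"
      by (simp add: increment_law_def)
    also have "\<dots> = distr M borel ((\<lambda>x. x - 2 * \<theta> / real n) \<circ> D i)"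
      by (rule distr_distr) auto
    finally show ?thesis by (simp add: comp_def)
  qed
  ultimately show ?thesis by (simp add: incr[abs_def] restrict_UNIV)
qed

text \<open>The two motions live on different spaces; both sides equal the same infinite
  product.\<close>

lemma distr_censored_increments:
  assumes B: "standard_brownian_motion M \<beta>" and B': "standard_brownian_motion N \<beta>'" and "0 < n"
  shows "distr M real_seqs (\<lambda>\<omega>. censor a b K r (increments (drifted \<theta> \<beta> \<omega>) n)) =
    distr N real_seqs (\<lambda>\<omega>. increments (drifted \<theta> \<beta>' \<omega>) n)"
proof -
  let ?S = "\<Pi>\<^sub>M i\<in>(UNIV :: nat set). increment_law \<theta> n"
  have "distr M real_seqs (\<lambda>\<omega>. censor a b K r (increments (drifted \<theta> \<beta> \<omega>) n)) =
      distr (distr M real_seqs (\<lambda>\<omega>. increments (drifted \<theta> \<beta> \<omega>) n)) real_seqs (censor a b K r)"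
    by (subst distr_distr) (auto intro!: measurable_increments_drifted[OF B] simp: comp_def)
  also have "\<dots> = distr ?S real_seqs (censor a b K r)"
    by (simp only: distr_increments_drifted[OF B \<open>0 < n\<close>])
  also have "\<dots> = distr ?S ?S (censor a b K r)"
    by (rule distr_cong) (simp_all add: sets_PiM_increment_law)
  also have "\<dots> = ?S"
    by (rule distr_censor[OF prob_space_increment_law[OF \<open>0 < n\<close>] sets_increment_law])
  finally show ?thesis by (simp only: distr_increments_drifted[OF B' \<open>0 < n\<close>])
qed

lemma measurable_path_map:
  assumes "\<And>t. 0 \<le> t \<Longrightarrow> X t \<in> borel_measurable M"
  shows "path_map X \<in> M \<rightarrow>\<^sub>M path_space"
  unfolding path_map_def path_space_def using assms by (intro measurable_restrict) auto

lemma same_law_compose: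
  assumes [measurable]: "U \<in> M \<rightarrow>\<^sub>M P" "U' \<in> N \<rightarrow>\<^sub>M P" and law: "distr M P U = distr N P U'"
    and [measurable]: "\<And>t. 0 \<le> t \<Longrightarrow> g t \<in> borel_measurable P"
  shows "same_law M (\<lambda>t \<omega>. g t (U \<omega>)) N (\<lambda>t \<omega>. g t (U' \<omega>))"
proof -
  have g: "path_map g \<in> P \<rightarrow>\<^sub>M path_space" by (rule measurable_path_map) measurable
  have "path_map (\<lambda>t \<omega>. g t (U \<omega>)) = path_map g \<circ> U" "path_map (\<lambda>t \<omega>. g t (U' \<omega>)) = path_map g \<circ> U'"
    by (auto simp: path_map_def)
  moreover have "distr M path_space (path_map g \<circ> U) = distr N path_space (path_map g \<circ> U')"
    using distr_distr[OF g assms(1)] distr_distr[OF g assms(2)] law by simp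
  ultimately show ?thesis
    using measurable_comp[OF assms(1) g] measurable_comp[OF assms(2) g]
    by (simp add: same_law_def)
qed

section \<open>Finite-dimensional laws and their limits\<close>

definition cylinder :: "real set \<Rightarrow> (real \<Rightarrow> real set) \<Rightarrow> (real \<Rightarrow> real) set" where
  "cylinder J F = {f \<in> extensional {0..}. \<forall>j\<in>J. f j \<in> F j}"

text \<open>Closed constraints are stable under intersection, generate the Borel sets, and have
  indicators that are limits of bounded continuous functions, through which almost sure convergence
  passes.\<close>

definition closed_cylinders :: "(real \<Rightarrow> real) set set" where
  "closed_cylinders = {cylinder J F |J F. finite J \<and> J \<subseteq> {0..} \<and> (\<forall>j. closed (F j))}"

lemma Int_stable_closed_cylinders: "Int_stable closed_cylinders"
proof (rule Int_stableI)
  fix A B assume "A \<in> closed_cylinders" "B \<in> closed_cylinders"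
  then obtain J F K G where A: "A = cylinder J F" "finite J" "J \<subseteq> {0..}" "\<And>j. closed (F j)"
    and B: "B = cylinder K G" "finite K" "K \<subseteq> {0..}" "\<And>j. closed (G j)"
    by (auto simp: closed_cylinders_def)
  \<comment> \<open>A coordinate constrained in only one of the cylinders is padded with
    \<open>UNIV\<close>.\<close>
  let ?H = "\<lambda>j. (if j \<in> J then F j else UNIV) \<inter> (if j \<in> K then G j else UNIV)"
  have "A \<inter> B = cylinder (J \<union> K) ?H"
    by (auto simp: A(1) B(1) cylinder_def)
  moreover have "closed (?H j)" for j using A B by (auto intro: closed_Int)
  ultimately show "A \<inter> B \<in> closed_cylinders"
    unfolding closed_cylinders_def using A(2,3) B(2,3) by (blast intro: finite_UnI)
qed

lemma sets_path_space: "sets path_space = sigma_sets (extensional {0..}) closed_cylinders"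
proof -
  define \<J> where "\<J> = {J. finite J \<and> J \<subseteq> {0::real..}}"
  define P where "P = {{f \<in> \<Pi>\<^sub>E i\<in>{0::real..}. (UNIV :: real set). \<forall>i\<in>J. f i \<in> A i} |A J.
      J \<in> \<J> \<and> A \<in> Pi J (\<lambda>_. Collect closed)}"
  have "sets path_space = sets (\<Pi>\<^sub>M i\<in>{0::real..}. sigma UNIV (Collect closed) :: real measure)"
    unfolding path_space_def borel_eq_closed ..
  also have "\<dots> = sets (sigma (\<Pi>\<^sub>E i\<in>{0..}. UNIV) P)"
    unfolding P_def
  proof (rule sets_PiM_sigma)
    show "\<Union>\<J> = {0..}" by (auto simp: \<J>_def intro!: exI[of _ "{x}" for x])
    show "\<exists>S\<subseteq>Collect closed. countable S \<and> (UNIV :: real set) = \<Union>S"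
      by (intro exI[of _ "{UNIV}"]) auto
  qed (auto simp: \<J>_def)
  also have "P = closed_cylinders"
  proof (intro equalityI subsetI)
    fix S assume "S \<in> P"
    then obtain A J where S: "S = {f \<in> \<Pi>\<^sub>E i\<in>{0..}. UNIV. \<forall>i\<in>J. f i \<in> A i}"
      and J: "finite J" "J \<subseteq> {0..}" "\<forall>i\<in>J. closed (A i)"
      by (auto simp: P_def \<J>_def)
    have "S = cylinder J (\<lambda>j. if j \<in> J then A j else UNIV)"
      by (auto simp: S cylinder_def PiE_def)
    moreover have "closed (if j \<in> J then A j else UNIV)" for j using J by auto
    ultimately show "S \<in> closed_cylinders"
      using J(1,2) unfolding closed_cylinders_def by blast
  next
    fix S assume "S \<in> closed_cylinders"
    then show "S \<in> P"
      by (auto simp: P_def \<J>_def closed_cylinders_def cylinder_def PiE_def)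
  qed
  finally have "sets path_space = sets (sigma (\<Pi>\<^sub>E i\<in>{0::real..}. UNIV) closed_cylinders)" .
  moreover have "closed_cylinders \<subseteq> Pow (extensional {0..})"
    by (auto simp: closed_cylinders_def cylinder_def)
  ultimately show ?thesis by (simp add: PiE_def)
qed

text \<open>The empty set is treated separately because \<open>infdist x {} = 0\<close>.\<close>

definition closed_approx :: "nat \<Rightarrow> real set \<Rightarrow> real \<Rightarrow> real" where
  "closed_approx m F x = (if F = {} then 0 else max 0 (1 - real m * infdist x F))"

lemma closed_approx_bounds: "0 \<le> closed_approx m F x" "closed_approx m F x \<le> 1"
  by (auto simp: closed_approx_def infdist_nonneg)

lemma continuous_closed_approx: "continuous_on UNIV (closed_approx m F)"
  unfolding closed_approx_def by (cases "F = {}") (auto intro!: continuous_intros)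

lemma borel_measurable_closed_approx [measurable]: "closed_approx m F \<in> borel_measurable borel"
  by (rule borel_measurable_continuous_onI) (rule continuous_closed_approx)

lemma tendsto_closed_approx:
  assumes "closed F"
  shows "(\<lambda>m. closed_approx m F x) \<longlonglongrightarrow> indicator F x"
proof (cases "x \<in> F")
  case True
  then have "closed_approx m F x = 1" for m by (auto simp: closed_approx_def)
  with True show ?thesis by simp
next
  case False
  show ?thesis
  proof (cases "F = {}")
    case False
    then have "0 < infdist x F"
      using assms \<open>x \<notin> F\<close> in_closed_iff_infdist_zero[of F x] infdist_nonneg[of x F] by linarith
    then obtain k :: nat where k: "1 / infdist x F \<le> real k" using real_arch_simple by blast
    have "closed_approx m F x = 0" if "k \<le> m" for m
    proof -
      have "1 / infdist x F \<le> real m" using k that by simp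
      then have "1 \<le> real m * infdist x F" using \<open>0 < infdist x F\<close> by (simp add: divide_le_eq)
      then show ?thesis by (simp add: closed_approx_def)
    qed
    then have "\<forall>\<^sub>F m in sequentially. closed_approx m F x = 0"
      unfolding eventually_sequentially by blast
    then show ?thesis using \<open>x \<notin> F\<close> by (simp add: tendsto_eventually)
  qed (simp add: closed_approx_def)
qed

lemma measure_cylinder_tendsto:
  assumes "prob_space M" and X: "\<And>t. 0 \<le> t \<Longrightarrow> X t \<in> borel_measurable M"
    and J: "finite J" "J \<subseteq> {0..}" and F: "\<And>j. closed (F j)"
  shows "(\<lambda>m. \<integral>\<omega>. (\<Prod>j\<in>J. closed_approx m (F j) (X j \<omega>)) \<partial>M)
    \<longlonglongrightarrow> measure (distr M path_space (path_map X)) (cylinder J F)"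
proof -
  interpret prob_space M by fact
  have Xj [measurable]: "X j \<in> borel_measurable M" if "j \<in> J" for j using X that J by auto
  have F_sets [measurable]: "F j \<in> sets borel" for j using F by (rule borel_closed)
  have "cylinder J F \<in> sets path_space"
    using J F unfolding sets_path_space closed_cylinders_def by (intro sigma_sets.Basic) blast
  then have "measure (distr M path_space (path_map X)) (cylinder J F) =
      measure M (path_map X -` cylinder J F \<inter> space M)"
    by (intro measure_distr measurable_path_map X)
  also have "path_map X -` cylinder J F \<inter> space M = {\<omega> \<in> space M. \<forall>j\<in>J. X j \<omega> \<in> F j}"
    using J(2) by (auto simp: path_map_def cylinder_def)
  also have "measure M \<dots> = (\<integral>\<omega>. (\<Prod>j\<in>J. indicator (F j) (X j \<omega>)) \<partial>M)"
  proof -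
    have "(\<integral>\<omega>. (\<Prod>j\<in>J. indicator (F j) (X j \<omega>) :: real) \<partial>M) =
        (\<integral>\<omega>. indicator {\<omega> \<in> space M. \<forall>j\<in>J. X j \<omega> \<in> F j} \<omega> \<partial>M)"
    proof (rule Bochner_Integration.integral_cong[OF refl])
      fix \<omega> assume "\<omega> \<in> space M"
      then show "(\<Prod>j\<in>J. indicator (F j) (X j \<omega>)) =
          (indicator {\<omega> \<in> space M. \<forall>j\<in>J. X j \<omega> \<in> F j} \<omega> :: real)"
        using J(1) by (auto simp: indicator_def prod_zero_iff)
    qed
    also have "\<dots> = measure M {\<omega> \<in> space M. \<forall>j\<in>J. X j \<omega> \<in> F j}"
      by (simp add: Int_absorb2 subset_eq)
    finally show ?thesis ..
  qed
  finally have *: "measure (distr M path_space (path_map X)) (cylinder J F) =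
      (\<integral>\<omega>. (\<Prod>j\<in>J. indicator (F j) (X j \<omega>)) \<partial>M)" .
  show ?thesis
    unfolding *
  proof (rule integral_dominated_convergence[where w = "\<lambda>_. 1"])
    show "(\<lambda>\<omega>. \<Prod>j\<in>J. closed_approx m (F j) (X j \<omega>)) \<in> borel_measurable M" for m
      by (intro borel_measurable_prod measurable_compose[OF Xj borel_measurable_closed_approx])
    have "(\<lambda>\<omega>. indicator (F j) (X j \<omega>) :: real) \<in> borel_measurable M" if "j \<in> J" for j
      using that by measurable
    then show "(\<lambda>\<omega>. \<Prod>j\<in>J. indicator (F j) (X j \<omega>) :: real) \<in> borel_measurable M"
      by (intro borel_measurable_prod)
    show "AE \<omega> in M. norm (\<Prod>j\<in>J. closed_approx m (F j) (X j \<omega>)) \<le> 1" for m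
      by (auto intro!: AE_I2 prod_le_1 simp: abs_prod closed_approx_bounds)
    show "AE \<omega> in M. (\<lambda>m. \<Prod>j\<in>J. closed_approx m (F j) (X j \<omega>)) \<longlonglongrightarrow> (\<Prod>j\<in>J. indicator (F j) (X j \<omega>))"
      by (intro AE_I2 tendsto_prod tendsto_closed_approx F)
  qed simp
qed

text \<open>Convergence is taken at each fixed time and on each space separately. Bounded continuous
  functions of finitely many coordinates pass to the limit, their limits give closed cylinders, and
  these determine a law on \<open>path_space\<close>.\<close>

lemma same_law_limit:
  assumes M: "prob_space M" and N: "prob_space N"
    and law: "\<And>n. same_law M (Xn n) N (Yn n)"
    and X: "\<And>t. 0 \<le> t \<Longrightarrow> X t \<in> borel_measurable M" "\<And>t. 0 \<le> t \<Longrightarrow> AE \<omega> in M. (\<lambda>n. Xn n t \<omega>) \<longlonglongrightarrow> X t \<omega>"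
    and Y: "\<And>t. 0 \<le> t \<Longrightarrow> Y t \<in> borel_measurable N" "\<And>t. 0 \<le> t \<Longrightarrow> AE \<omega> in N. (\<lambda>n. Yn n t \<omega>) \<longlonglongrightarrow> Y t \<omega>"
  shows "same_law M X N Y"
proof -
  interpret M: prob_space M by fact
  interpret N: prob_space N by fact
  let ?PX = "distr M path_space (path_map X)" and ?PY = "distr N path_space (path_map Y)"
  have map: "path_map X \<in> M \<rightarrow>\<^sub>M path_space" "path_map Y \<in> N \<rightarrow>\<^sub>M path_space"
    using X(1) Y(1) by (auto intro: measurable_path_map)
  have lim: "(\<lambda>n. \<integral>\<omega>. (\<Prod>j\<in>J. closed_approx m (F j) (Zn n j \<omega>)) \<partial>Q) \<longlonglongrightarrow>
      (\<integral>\<omega>. (\<Prod>j\<in>J. closed_approx m (F j) (Z j \<omega>)) \<partial>Q)"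
    if Q: "prob_space Q" and Zn: "\<And>n. path_map (Zn n) \<in> Q \<rightarrow>\<^sub>M path_space"
      and Z: "\<And>t. 0 \<le> t \<Longrightarrow> Z t \<in> borel_measurable Q" "\<And>t. 0 \<le> t \<Longrightarrow> AE \<omega> in Q. (\<lambda>n. Zn n t \<omega>) \<longlonglongrightarrow> Z t \<omega>"
      and J: "finite J" "J \<subseteq> {0..}" for Q :: "'c measure" and Zn Z J m F
  proof (rule integral_dominated_convergence[where w = "\<lambda>_. 1"])
    interpret prob_space Q by fact
    show "integrable Q (\<lambda>_. 1 :: real)" by simp
    have "Zn n j \<in> borel_measurable Q" if "j \<in> J" for n j
    proof -
      have "(\<lambda>f. f j) \<in> borel_measurable path_space"
        unfolding path_space_def using that J by (intro measurable_component_singleton) auto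
      from measurable_compose[OF Zn this] show ?thesis using that J by (auto simp: path_map_def)
    qed
    then show "(\<lambda>\<omega>. \<Prod>j\<in>J. closed_approx m (F j) (Zn n j \<omega>)) \<in> borel_measurable Q" for n
      by (intro borel_measurable_prod measurable_compose[OF _ borel_measurable_closed_approx])
    have "Z j \<in> borel_measurable Q" if "j \<in> J" for j using Z(1) that J by auto
    then show "(\<lambda>\<omega>. \<Prod>j\<in>J. closed_approx m (F j) (Z j \<omega>)) \<in> borel_measurable Q"
      by (intro borel_measurable_prod measurable_compose[OF _ borel_measurable_closed_approx])
    show "AE \<omega> in Q. norm (\<Prod>j\<in>J. closed_approx m (F j) (Zn n j \<omega>)) \<le> 1" for n
      by (auto intro!: AE_I2 prod_le_1 simp: abs_prod closed_approx_bounds)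
    have "AE \<omega> in Q. \<forall>j\<in>J. (\<lambda>n. Zn n j \<omega>) \<longlonglongrightarrow> Z j \<omega>"
      using Z(2) J by (intro AE_finite_allI) auto
    then show "AE \<omega> in Q. (\<lambda>n. \<Prod>j\<in>J. closed_approx m (F j) (Zn n j \<omega>)) \<longlonglongrightarrow>
        (\<Prod>j\<in>J. closed_approx m (F j) (Z j \<omega>))"
    proof eventually_elim
      case (elim \<omega>)
      then show ?case
        by (intro tendsto_prod continuous_on_tendsto_compose[OF continuous_closed_approx]) auto
    qed
  qed
  have int_eq: "(\<integral>\<omega>. (\<Prod>j\<in>J. closed_approx m (F j) (X j \<omega>)) \<partial>M) =
      (\<integral>\<omega>. (\<Prod>j\<in>J. closed_approx m (F j) (Y j \<omega>)) \<partial>N)"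
    if J: "finite J" "J \<subseteq> {0..}" for J m F
  proof -
    define h where "h f = (\<Prod>j\<in>J. closed_approx m (F j) (f j))" for f :: "real \<Rightarrow> real"
    have h: "h \<in> borel_measurable path_space"
      unfolding h_def path_space_def using J
      by (intro borel_measurable_prod measurable_compose[OF _ borel_measurable_closed_approx]
          measurable_component_singleton) auto
    have h_path: "h (path_map Z \<omega>) = (\<Prod>j\<in>J. closed_approx m (F j) (Z j \<omega>))" for Z :: "real \<Rightarrow> 'c \<Rightarrow> real" and \<omega>
      unfolding h_def using J by (intro prod.cong) (auto simp: path_map_def)
    have h_path': "h (path_map Z \<omega>) = (\<Prod>j\<in>J. closed_approx m (F j) (Z j \<omega>))" for Z :: "real \<Rightarrow> 'd \<Rightarrow> real" and \<omega>
      unfolding h_def using J by (intro prod.cong) (auto simp: path_map_def)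
    have eq: "(\<integral>\<omega>. (\<Prod>j\<in>J. closed_approx m (F j) (Xn n j \<omega>)) \<partial>M) =
        (\<integral>\<omega>. (\<Prod>j\<in>J. closed_approx m (F j) (Yn n j \<omega>)) \<partial>N)" for n
      using law[of n] integral_distr[of "path_map (Xn n)" M path_space h]
        integral_distr[of "path_map (Yn n)" N path_space h] h
      unfolding same_law_def h_path h_path' by simp
    have "(\<lambda>n. \<integral>\<omega>. (\<Prod>j\<in>J. closed_approx m (F j) (Xn n j \<omega>)) \<partial>M) \<longlonglongrightarrow>
        (\<integral>\<omega>. (\<Prod>j\<in>J. closed_approx m (F j) (X j \<omega>)) \<partial>M)"
      using law by (intro lim[OF M _ X J]) (auto simp: same_law_def)
    moreover have "(\<lambda>n. \<integral>\<omega>. (\<Prod>j\<in>J. closed_approx m (F j) (Yn n j \<omega>)) \<partial>N) \<longlonglongrightarrow>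
        (\<integral>\<omega>. (\<Prod>j\<in>J. closed_approx m (F j) (Y j \<omega>)) \<partial>N)"
      using law by (intro lim[OF N _ Y J]) (auto simp: same_law_def)
    ultimately show ?thesis unfolding eq by (rule LIMSEQ_unique)
  qed
  have "?PX = ?PY"
  proof (rule measure_eqI_generator_eq[OF Int_stable_closed_cylinders])
    show "closed_cylinders \<subseteq> Pow (extensional {0..})"
      by (auto simp: closed_cylinders_def cylinder_def)
    interpret PX: prob_space ?PX by (rule M.prob_space_distr[OF map(1)])
    interpret PY: prob_space ?PY by (rule N.prob_space_distr[OF map(2)])
    show "emeasure ?PX A = emeasure ?PY A" if cyl: "A \<in> closed_cylinders" for A
    proof -
      obtain J F where A: "A = cylinder J F" and J: "finite J" "J \<subseteq> {0..}" and F: "\<forall>j. closed (F j)"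
        using cyl unfolding closed_cylinders_def by blast
      have "(\<lambda>m. \<integral>\<omega>. (\<Prod>j\<in>J. closed_approx m (F j) (X j \<omega>)) \<partial>M) \<longlonglongrightarrow> measure ?PX (cylinder J F)"
        by (rule measure_cylinder_tendsto[where X = X and F = F, OF M]) (use X(1) J F in auto)
      moreover have "(\<lambda>m. \<integral>\<omega>. (\<Prod>j\<in>J. closed_approx m (F j) (Y j \<omega>)) \<partial>N) \<longlonglongrightarrow> measure ?PY (cylinder J F)"
        by (rule measure_cylinder_tendsto[where X = Y and F = F, OF N]) (use Y(1) J F in auto)
      ultimately have "measure ?PX A = measure ?PY A"
        unfolding A int_eq[OF J] by (rule LIMSEQ_unique)
      then show ?thesis by (simp add: PX.emeasure_eq_measure PY.emeasure_eq_measure)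
    qed
    show "range (\<lambda>_. cylinder {} (\<lambda>_. UNIV)) \<subseteq> closed_cylinders" by (auto simp: closed_cylinders_def)
    show "emeasure ?PX (cylinder {} (\<lambda>_. UNIV)) \<noteq> \<infinity>" by (simp add: PX.emeasure_eq_measure)
    show "(\<Union>i::nat. cylinder {} (\<lambda>_. UNIV)) = extensional {0..}" by (simp add: cylinder_def)
  qed (simp_all add: sets_path_space)
  then show ?thesis using map by (simp add: same_law_def)
qed

section \<open>Measurability of the projection\<close>

locale continuous_process =
  fixes M :: "'w measure" and Y :: "real \<Rightarrow> 'w \<Rightarrow> real"
  assumes process_measurable: "\<And>t. 0 \<le> t \<Longrightarrow> Y t \<in> borel_measurable M"
    and process_continuous: "\<And>\<omega>. \<omega> \<in> space M \<Longrightarrow> continuous_on {0..} (\<lambda>t. Y t \<omega>)"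
begin

text \<open>The process is a limit of processes constant on mesh cells. Values at negative times are
  arbitrary, so \<open>max 0 s\<close> freezes the path at its value at 0.\<close>

lemma process_jointly_measurable:
  "(\<lambda>(\<omega>, s). Y (max 0 s) \<omega>) \<in> borel_measurable (M \<Otimes>\<^sub>M borel)"
proof (rule borel_measurable_LIMSEQ_real)
  fix n :: nat
  have "(\<lambda>p. Y (real (nat \<lfloor>real n * snd p\<rfloor>) / real n) (fst p)) \<in> borel_measurable (M \<Otimes>\<^sub>M borel)"
  proof (rule measurable_compose_countable[where g = "\<lambda>p. nat \<lfloor>real n * snd p\<rfloor>"])
    show "(\<lambda>p. Y (real k / real n) (fst p)) \<in> borel_measurable (M \<Otimes>\<^sub>M borel)" for k
      by (rule measurable_compose[OF measurable_fst]) (simp add: process_measurable)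
    show "(\<lambda>p. nat \<lfloor>real n * snd p\<rfloor>) \<in> M \<Otimes>\<^sub>M borel \<rightarrow>\<^sub>M count_space UNIV"
      by measurable
  qed
  then show "(\<lambda>(\<omega>, s). Y (real (nat \<lfloor>real n * s\<rfloor>) / real n) \<omega>) \<in> borel_measurable (M \<Otimes>\<^sub>M borel)"
    by (simp add: case_prod_unfold)
next
  fix p assume "p \<in> space (M \<Otimes>\<^sub>M (borel :: real measure))"
  then obtain \<omega> s where p: "p = (\<omega>, s)" "\<omega> \<in> space M" by (auto simp: space_pair_measure)
  have "(\<lambda>n. real (nat \<lfloor>real n * s\<rfloor>) / real n) \<longlonglongrightarrow> max 0 s"
  proof (cases "0 \<le> s")
    case True
    have le: "real (nat \<lfloor>real n * s\<rfloor>) \<le> real n * s" "real n * s - 1 \<le> real (nat \<lfloor>real n * s\<rfloor>)" for n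
    proof -
      show "real (nat \<lfloor>real n * s\<rfloor>) \<le> real n * s" using True by simp
      show "real n * s - 1 \<le> real (nat \<lfloor>real n * s\<rfloor>)" by linarith
    qed
    have "(\<lambda>n. real (nat \<lfloor>real n * s\<rfloor>) / real n) \<longlonglongrightarrow> s"
    proof (rule real_tendsto_sandwich[of "\<lambda>n. s - 1 / real n" _ _ "\<lambda>n. s"])
      show "\<forall>\<^sub>F n in sequentially. real (nat \<lfloor>real n * s\<rfloor>) / real n \<le> s"
        using eventually_gt_at_top[of 0]
      proof eventually_elim
        case (elim n)
        then show ?case using le(1)[of n] by (simp only: pos_divide_le_eq of_nat_0_less_iff mult.commute)
      qed
      show "\<forall>\<^sub>F n in sequentially. s - 1 / real n \<le> real (nat \<lfloor>real n * s\<rfloor>) / real n"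
        using eventually_gt_at_top[of 0]
      proof eventually_elim
        case (elim n)
        then have "(real n * s - 1) / real n \<le> real (nat \<lfloor>real n * s\<rfloor>) / real n"
          using le(2) by (intro divide_right_mono) auto
        then show ?case using elim by (simp add: diff_divide_distrib)
      qed
      show "(\<lambda>n. s - 1 / real n) \<longlonglongrightarrow> s"
        using tendsto_diff[OF tendsto_const lim_1_over_n, of s] by simp
    qed simp
    with True show ?thesis by simp
  next
    case False
    then have "real n * s \<le> 0" for n by (simp add: mult_nonneg_nonpos)
    then have "real n * s < 1" for n by (rule le_less_trans) simp
    then have "nat \<lfloor>real n * s\<rfloor> = 0" for n by simp
    with False show ?thesis by simp
  qed
  from continuous_on_tendsto_compose[OF process_continuous[OF p(2)] this]
  show "(\<lambda>n. case p of (\<omega>, s) \<Rightarrow> Y (real (nat \<lfloor>real n * s\<rfloor>) / real n) \<omega>) \<longlonglongrightarrow>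
      (case p of (\<omega>, s) \<Rightarrow> Y (max 0 s) \<omega>)"
    by (simp add: p)
qed

lemma process_random_time:
  assumes "\<tau> \<in> borel_measurable M"
  shows "(\<lambda>\<omega>. Y (max 0 (\<tau> \<omega>)) \<omega>) \<in> borel_measurable M"
proof -
  have "(\<lambda>\<omega>. (\<omega>, \<tau> \<omega>)) \<in> M \<rightarrow>\<^sub>M M \<Otimes>\<^sub>M borel"
    using assms by measurable
  from measurable_compose[OF this process_jointly_measurable] show ?thesis by simp
qed

lemma measurable_time_below: "(\<lambda>\<omega>. time_below b (\<lambda>s. Y s \<omega>) r) \<in> borel_measurable M"
proof -
  have [measurable]: "(\<lambda>p. Y (max 0 (snd p)) (fst p)) \<in> borel_measurable (M \<Otimes>\<^sub>M lborel)"
    using process_jointly_measurable by (simp add: case_prod_unfold cong: measurable_cong_sets)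
  have "(\<lambda>p. indicator {0..r} (snd p) * (if Y (max 0 (snd p)) (fst p) \<le> b then 1 else 0 :: real))
      \<in> borel_measurable (M \<Otimes>\<^sub>M lborel)"
    by measurable
  then have "(\<lambda>\<omega>. LINT s|lborel. indicator {0..r} s * (if Y (max 0 s) \<omega> \<le> b then 1 else 0 :: real))
      \<in> borel_measurable M"
    by (intro lborel.borel_measurable_lebesgue_integral) (simp add: case_prod_unfold)
  moreover have "time_below b (\<lambda>s. Y s \<omega>) r =
      (LINT s|lborel. indicator {0..r} s * (if Y (max 0 s) \<omega> \<le> b then 1 else 0 :: real))" for \<omega>
    unfolding time_below_def set_lebesgue_integral_def
    by (intro Bochner_Integration.integral_cong) (auto simp: indicator_def)
  ultimately show ?thesis by simp
qed

text \<open>The clock is nondecreasing, so a rational slightly above an admissible time is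
  admissible as well, and the infimum becomes countable.\<close>

lemma measurable_inv_time_below: "(\<lambda>\<omega>. inv_time_below b (\<lambda>s. Y s \<omega>) t) \<in> borel_measurable M"
proof -
  let ?A = "\<lambda>\<omega>. time_below b (\<lambda>s. Y s \<omega>)"
  define Q where "Q = {q \<in> \<rat>. (0::real) \<le> q}"
  have "countable Q" unfolding Q_def by (rule countable_subset[OF _ countable_rat]) auto
  have A [measurable]: "(\<lambda>\<omega>. ?A \<omega> q) \<in> borel_measurable M" for q by (rule measurable_time_below)
  have "(\<lambda>\<omega>. INF q\<in>Q. if t < ?A \<omega> q then ereal q else \<infinity>) \<in> borel_measurable M"
    using \<open>countable Q\<close> by (intro borel_measurable_INF) measurable
  moreover have "inv_time_below b (\<lambda>s. Y s \<omega>) t = (INF q\<in>Q. if t < ?A \<omega> q then ereal q else \<infinity>)"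
    if \<omega>: "\<omega> \<in> space M" for \<omega>
  proof (rule antisym)
    interpret clocked_path "\<lambda>s. Y s \<omega>" b by unfold_locales (rule process_continuous[OF \<omega>])
    show "inv_time_below b (\<lambda>s. Y s \<omega>) t \<le> (INF q\<in>Q. if t < ?A \<omega> q then ereal q else \<infinity>)"
      unfolding inv_time_below_def by (rule INF_greatest) (auto simp: Q_def intro!: Inf_lower)
    show "(INF q\<in>Q. if t < ?A \<omega> q then ereal q else \<infinity>) \<le> inv_time_below b (\<lambda>s. Y s \<omega>) t"
      unfolding inv_time_below_def
    proof (rule Inf_greatest)
      fix x assume "x \<in> ereal ` {r. 0 \<le> r \<and> t < ?A \<omega> r}"
      then obtain r where r: "x = ereal r" "0 \<le> r" "t < ?A \<omega> r" by auto
      show "(INF q\<in>Q. if t < ?A \<omega> q then ereal q else \<infinity>) \<le> x"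
        unfolding r(1)
      proof (rule ereal_le_epsilon2)
        fix e :: real assume "0 < e"
        then obtain q where q: "q \<in> \<rat>" "r < q" "q < r + e" using Rats_dense_in_real[of r "r + e"] by auto
        then have "t < ?A \<omega> q" using r time_below_mono[of r q] by linarith
        then have "(INF q\<in>Q. if t < ?A \<omega> q then ereal q else \<infinity>) \<le> ereal q"
          using q r(2) by (intro INF_lower2[of q]) (auto simp: Q_def)
        also have "\<dots> \<le> ereal r + ereal e" using q by simp
        finally show "(INF q\<in>Q. if t < ?A \<omega> q then ereal q else \<infinity>) \<le> ereal r + ereal e" .
      qed
    qed
  qed
  ultimately show ?thesis by (simp cong: measurable_cong)
qed

lemma measurable_path_proj: "(\<lambda>\<omega>. path_proj b (\<lambda>s. Y s \<omega>) t) \<in> borel_measurable M"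
proof -
  let ?C = "\<lambda>\<omega>. inv_time_below b (\<lambda>s. Y s \<omega>) t"
  note [measurable] = measurable_inv_time_below
  have [measurable]: "(\<lambda>\<omega>. Y (max 0 (real_of_ereal (?C \<omega>))) \<omega>) \<in> borel_measurable M"
    by (rule process_random_time) measurable
  have "(\<lambda>\<omega>. if ?C \<omega> = \<infinity> then b else Y (max 0 (real_of_ereal (?C \<omega>))) \<omega>) \<in> borel_measurable M"
    by measurable
  moreover have "path_proj b (\<lambda>s. Y s \<omega>) t = (if ?C \<omega> = \<infinity> then b else Y (max 0 (real_of_ereal (?C \<omega>))) \<omega>)" for \<omega>
  proof -
    \<comment> \<open>This excludes the value minus infinity, so the default branch of
      \<open>path_proj\<close> is the case of an infinite inverse.\<close>
    have "0 \<le> ?C \<omega>" unfolding inv_time_below_def by (rule Inf_greatest) auto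
    then show ?thesis by (cases "?C \<omega>") (auto simp: path_proj_def)
  qed
  ultimately show ?thesis by simp
qed

end

section \<open>Recurrence and the conclusion\<close>

text \<open>In rescaled time: a rise of \<open>d\<close> within a window of length
  \<open>1 / Suc m\<close>. Stated for a sequence, it is an event determined by the increments, so
  its probability can be compared across spaces. The horizon \<open>Suc T\<close> leaves room for
  the error of the discrete clock.\<close>

definition oscillates :: "real \<Rightarrow> nat \<Rightarrow> nat \<Rightarrow> nat \<Rightarrow> (nat \<Rightarrow> real) \<Rightarrow> bool" where
  "oscillates d T m n z \<longleftrightarrow>
     (\<exists>i j. i \<le> j \<and> j \<le> n * Suc T \<and> real (j - i) \<le> 1 / real (Suc m) * real n \<and> d \<le> z j - z i)"

lemma oscillates_mono: "oscillates d T m' n z \<Longrightarrow> m \<le> m' \<Longrightarrow> oscillates d T m n z"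
proof -
  assume "m \<le> m'"
  then have "1 / real (Suc m') * real n \<le> 1 / real (Suc m) * real n"
    by (intro mult_right_mono divide_left_mono) auto
  then show "oscillates d T m' n z \<Longrightarrow> oscillates d T m n z"
    unfolding oscillates_def by (meson order_trans)
qed

lemma measurable_oscillates [measurable]:
  assumes [measurable]: "\<And>k. (\<lambda>x. z x k) \<in> borel_measurable M"
  shows "Measurable.pred M (\<lambda>x. oscillates d T m n (z x))"
  unfolding oscillates_def by measurable

text \<open>The window comes from uniform continuity of the limit path. Path oscillation and the
  approximation at both ends cost \<open>d / 4\<close> each, in total less than
  \<open>d\<close>.\<close>

lemma reflected_walk_not_oscillates:
  assumes \<phi>: "two_sided_reflection c w \<phi>" and "0 < c" "0 < d"
  shows "\<exists>m. \<forall>\<^sub>F n in sequentially. \<not> oscillates d T m n (reflected_walk c 0 (increments w n))"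
proof -
  have cont: "continuous_on {0..} \<phi>"
    using \<phi> by (simp add: two_sided_reflection_def cont_paths_def)
  have "\<forall>\<^sub>F n in sequentially. 0 < n \<and> (\<forall>s\<in>{0..real (Suc T)}. \<forall>t\<in>{0..real (Suc T)}.
      \<bar>s - t\<bar> \<le> 1 / real n \<longrightarrow> \<bar>\<phi> s - \<phi> t\<bar> \<le> d / 4)"
    using \<open>0 < d\<close> by (intro eventually_conj eventually_gt_at_top eventually_mesh_oscillation cont) simp
  then obtain M where "0 < M" and "\<forall>s\<in>{0..real (Suc T)}. \<forall>t\<in>{0..real (Suc T)}.
      \<bar>s - t\<bar> \<le> 1 / real M \<longrightarrow> \<bar>\<phi> s - \<phi> t\<bar> \<le> d / 4"
    by (auto dest: eventually_happens)
  then obtain m where m: "\<And>s t. s \<in> {0..real (Suc T)} \<Longrightarrow> t \<in> {0..real (Suc T)} \<Longrightarrow>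
      \<bar>s - t\<bar> \<le> 1 / real (Suc m) \<Longrightarrow> \<bar>\<phi> s - \<phi> t\<bar> \<le> d / 4"
    by (metis gr0_implies_Suc)
  have "\<forall>\<^sub>F n in sequentially. 0 < n \<and>
      (\<forall>k\<le>n * Suc T. \<bar>reflected_walk c 0 (increments w n) k - \<phi> (real k / real n)\<bar> \<le> d / 4)"
    using assms by (intro eventually_conj eventually_gt_at_top reflected_walk_approx[OF \<phi>]) simp_all
  then have "\<forall>\<^sub>F n in sequentially. \<not> oscillates d T m n (reflected_walk c 0 (increments w n))"
  proof eventually_elim
    case (elim n)
    show ?case
    proof
      let ?z = "reflected_walk c 0 (increments w n)"
      assume "oscillates d T m n ?z"
      then obtain i j where ij: "i \<le> j" "j \<le> n * Suc T" "real (j - i) \<le> 1 / real (Suc m) * real n"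
        and d: "d \<le> ?z j - ?z i"
        unfolding oscillates_def by blast
      have n: "0 < n" using elim by simp
      have "i \<le> n * Suc T" using ij by simp
      have "(real j - real i) / real n \<le> 1 / real (Suc m)"
        using ij n by (simp only: of_nat_diff pos_divide_le_eq of_nat_0_less_iff)
      moreover have "0 \<le> (real j - real i) / real n" using ij n by simp
      ultimately have "\<bar>real j / real n - real i / real n\<bar> \<le> 1 / real (Suc m)"
        by (simp only: diff_divide_distrib abs_of_nonneg)
      then have "\<bar>\<phi> (real j / real n) - \<phi> (real i / real n)\<bar> \<le> d / 4"
        using mesh_mem[OF n ij(2)] mesh_mem[OF n \<open>i \<le> n * Suc T\<close>] by (intro m)
      moreover have "\<bar>?z j - \<phi> (real j / real n)\<bar> \<le> d / 4" "\<bar>?z i - \<phi> (real i / real n)\<bar> \<le> d / 4"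
        using elim ij(2) \<open>i \<le> n * Suc T\<close> by blast+
      ultimately show False using d \<open>0 < d\<close> by linarith
    qed
  qed
  then show ?thesis ..
qed

text \<open>Without a zero after \<open>m\<close> the lower push is frozen, so over the unit
  interval the path falls at least as much as \<open>w\<close>, that is by more than the width
  \<open>c\<close>.\<close>

lemma two_sided_reflection_zero:
  assumes \<phi>: "two_sided_reflection c w \<phi>" and decrease: "increments w 1 m \<le> - (c + 1)"
  shows "\<exists>s\<ge>real m. \<phi> s = 0"
proof (rule ccontr)
  assume no_zero: "\<not> ?thesis"
  obtain l u where mem: "\<And>t. 0 \<le> t \<Longrightarrow> \<phi> t \<in> {0..c}"
    and eq: "\<And>t. 0 \<le> t \<Longrightarrow> \<phi> t = w t + l t - u t"
    and mono: "\<And>s t. 0 \<le> s \<Longrightarrow> s \<le> t \<Longrightarrow> u s \<le> u t"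
    and flat: "\<And>s t. 0 \<le> s \<Longrightarrow> s \<le> t \<Longrightarrow> \<forall>v\<in>{s..t}. \<phi> v \<noteq> 0 \<Longrightarrow> l s = l t"
    using \<phi> unfolding two_sided_reflection_def cont_paths_def by blast
  have "l (real m) = l (real m + 1)" using no_zero by (intro flat) auto
  moreover have "u (real m) \<le> u (real m + 1)" by (intro mono) auto
  moreover have "w (real m + 1) - w (real m) \<le> - (c + 1)"
    using decrease by (simp add: increments_def add.commute)
  ultimately have "\<phi> (real m + 1) \<le> \<phi> (real m) - (c + 1)"
    using eq[of "real m"] eq[of "real m + 1"] by simp
  then show False using mem[of "real m"] mem[of "real m + 1"] by simp
qed

context censored_path
begin

text \<open>A bounded clock has less than \<open>1 / Suc m\<close> left after some time. A later
  passage from 0 to above \<open>b\<close> must fit into this remainder.\<close>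

lemma censored_walk_eventually_oscillates:
  assumes bounded: "\<And>k :: nat. A (real k) \<le> real T" and zeros: "\<And>J :: nat. \<exists>s\<ge>real J. \<phi> s = 0"
  shows "\<forall>\<^sub>F n in sequentially. oscillates (b / 2) T m n (Z n)"
proof -
  have A_le: "A r \<le> real T" if "0 \<le> r" for r
  proof -
    obtain k :: nat where "r \<le> real k" using real_arch_simple by blast
    then show ?thesis using time_below_mono[of r "real k"] bounded[of k] that by linarith
  qed
  define \<sigma> where "\<sigma> = Sup (A ` {0..})"
  have bdd: "bdd_above (A ` {0..})" using A_le by (intro bdd_aboveI2) auto
  have le_\<sigma>: "A r \<le> \<sigma>" if "0 \<le> r" for r
    unfolding \<sigma>_def using bdd that by (intro cSup_upper) auto
  have "\<sigma> - 1 / real (Suc m) < \<sigma>" by simp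
  then obtain r where r: "0 \<le> r" "\<sigma> - 1 / real (Suc m) < A r"
    unfolding \<sigma>_def using less_cSup_iff[OF _ bdd] by auto
  obtain J :: nat where J: "r \<le> real J" using real_arch_simple by blast
  obtain s where s: "real J \<le> s" "\<phi> s = 0" using zeros by blast
  have s0: "0 \<le> s" "r \<le> s" using r J s by auto
  \<comment> \<open>A path staying at most \<open>b\<close> after \<open>s\<close> would drive the
    clock at unit speed beyond its bound \<open>T\<close>.\<close>
  have "\<exists>s'>s. b < \<phi> s'"
  proof (rule ccontr)
    assume *: "\<not> ?thesis"
    then have "\<phi> u \<le> b" if "s < u" for u using that by (meson not_le)
    then have "A (s + real T + 1) - A s = (s + real T + 1) - s"
      using s0 by (intro time_below_inside) auto
    then show False using A_le[of "s + real T + 1"] time_below_nonneg[of s] s0 by simp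
  qed
  then obtain s' where s': "s < s'" "b < \<phi> s'" by blast
  have "A r \<le> A s" by (rule time_below_mono) (use r s0 in auto)
  then have "A s' - A s < 1 / real (Suc m)" using r le_\<sigma>[of s'] s' s0 by simp
  from censored_walk_oscillates[OF s0(1) s'(1) s(2) s'(2) this A_le] s' s0
  show ?thesis unfolding oscillates_def by simp
qed

end

text \<open>A Fatou argument across two spaces: \<open>B\<close> has at most the limiting
  probability of \<open>B \<inter> E n\<close>, which is bounded by that of \<open>F n\<close>, and
  \<open>F n\<close> dies out on the event that it eventually fails.\<close>

lemma measure_eventually_le:
  assumes "prob_space M" "prob_space N" and B: "B \<in> sets M"
    and E: "\<And>n. E n \<in> sets M" and F: "\<And>n. F n \<in> sets N" and eq: "\<And>n. measure M (E n) = measure N (F n)"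
    and ev: "AE \<omega> in M. \<omega> \<in> B \<longrightarrow> (\<forall>\<^sub>F n in sequentially. \<omega> \<in> E n)"
  shows "measure M B \<le> 1 - measure N {\<omega> \<in> space N. \<forall>\<^sub>F n in sequentially. \<omega> \<notin> F n}"
proof -
  interpret M: prob_space M by fact
  interpret N: prob_space N by fact
  let ?G = "{\<omega> \<in> space N. \<forall>\<^sub>F n in sequentially. \<omega> \<notin> F n}"
  have F' [measurable]: "Measurable.pred N (\<lambda>\<omega>. \<omega> \<in> F n)" for n
    using F by measurable
  have G: "?G \<in> sets N"
    unfolding eventually_sequentially by measurable
  have "(\<lambda>n. \<integral>\<omega>. indicator (B \<inter> E n) \<omega> \<partial>M) \<longlonglongrightarrow> (\<integral>\<omega>. (indicator B \<omega> :: real) \<partial>M)"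
  proof (rule integral_dominated_convergence[where w = "\<lambda>_. 1"])
    show "AE \<omega> in M. (\<lambda>n. indicator (B \<inter> E n) \<omega>) \<longlonglongrightarrow> (indicator B \<omega> :: real)"
      using ev
    proof eventually_elim
      case (elim \<omega>)
      show ?case
      proof (cases "\<omega> \<in> B")
        case True
        with elim have "\<forall>\<^sub>F n in sequentially. indicator (B \<inter> E n) \<omega> = (indicator B \<omega> :: real)"
          by (auto elim: eventually_mono)
        then show ?thesis by (rule tendsto_eventually)
      qed simp
    qed
    show "AE \<omega> in M. norm (indicator (B \<inter> E n) \<omega> :: real) \<le> 1" for n by (simp add: indicator_def)
  qed (use B E in auto)
  then have limM: "(\<lambda>n. measure M (B \<inter> E n)) \<longlonglongrightarrow> measure M B"
    using B E by (simp add: Int_absorb2 sets.sets_into_space)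
  have "(\<lambda>n. \<integral>\<omega>. indicator (F n \<inter> ?G) \<omega> \<partial>N) \<longlonglongrightarrow> (\<integral>\<omega>. (0 :: real) \<partial>N)"
  proof (rule integral_dominated_convergence[where w = "\<lambda>_. 1"])
    show "AE \<omega> in N. (\<lambda>n. indicator (F n \<inter> ?G) \<omega>) \<longlonglongrightarrow> (0 :: real)"
    proof (rule AE_I2)
      fix \<omega>
      show "(\<lambda>n. indicator (F n \<inter> ?G) \<omega>) \<longlonglongrightarrow> (0 :: real)"
      proof (cases "\<omega> \<in> ?G")
        case True
        then have "\<forall>\<^sub>F n in sequentially. \<omega> \<notin> F n" by simp
        then have "\<forall>\<^sub>F n in sequentially. indicator (F n \<inter> ?G) \<omega> = (0 :: real)"
          by (rule eventually_mono) simp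
        then show ?thesis by (rule tendsto_eventually)
      qed simp
    qed
    show "AE \<omega> in N. norm (indicator (F n \<inter> ?G) \<omega> :: real) \<le> 1" for n by (simp add: indicator_def)
    show "(\<lambda>\<omega>. indicator (F n \<inter> ?G) \<omega> :: real) \<in> borel_measurable N" for n
      using F G by (intro borel_measurable_indicator sets.Int)
  qed auto
  moreover have "(\<integral>\<omega>. indicator (F n \<inter> ?G) \<omega> \<partial>N) = measure N (F n \<inter> ?G)" for n
    using sets.sets_into_space[OF sets.Int[OF F G]] by (simp add: Int_absorb2)
  ultimately have limN: "(\<lambda>n. measure N (F n \<inter> ?G) + (1 - measure N ?G)) \<longlonglongrightarrow> 0 + (1 - measure N ?G)"
    by (intro tendsto_add tendsto_const) simp
  have "measure M (B \<inter> E n) \<le> measure N (F n \<inter> ?G) + (1 - measure N ?G)" for n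
  proof -
    have "measure M (B \<inter> E n) \<le> measure N (F n)"
      unfolding eq[symmetric] by (rule M.finite_measure_mono) (use E in auto)
    also have "\<dots> \<le> measure N ((F n \<inter> ?G) \<union> (space N - ?G))"
      using sets.sets_into_space[OF F] by (intro N.finite_measure_mono sets.Un sets.Int sets.Diff F G) auto
    also have "\<dots> \<le> measure N (F n \<inter> ?G) + measure N (space N - ?G)"
      by (intro measure_Un_le sets.Int sets.Diff F G) auto
    also have "measure N (space N - ?G) = 1 - measure N ?G"
      by (rule N.prob_compl[OF G])
    finally show ?thesis .
  qed
  then have "measure M B \<le> 0 + (1 - measure N ?G)"
    by (intro LIMSEQ_le[OF limM limN]) auto
  then show ?thesis by simp
qed

text \<open>The i.i.d. increments over unit intervals exceed \<open>- c\<close> with probability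
  \<open>q < 1\<close>, so the probability that all of them do so from \<open>J\<close> on is a
  limit of powers of \<open>q\<close>.\<close>

lemma AE_large_decrease:
  assumes B: "standard_brownian_motion M \<beta>"
  shows "AE \<omega> in M. \<forall>J :: nat. \<exists>m\<ge>J. increments (drifted \<theta> \<beta> \<omega>) 1 m \<le> - c"
proof -
  let ?\<nu> = "increment_law \<theta> 1"
  interpret \<nu>: prob_space ?\<nu> by (rule prob_space_increment_law) simp
  interpret sequence_space ?\<nu>
    by (simp add: sequence_space_def product_prob_space_def product_prob_space_axioms_def
        product_sigma_finite_def \<nu>.prob_space_axioms \<nu>.sigma_finite_measure_axioms del: One_nat_def)
  define q where "q = measure ?\<nu> {- c<..}"
  have "q < 1"
  proof (rule ccontr)
    assume "\<not> q < 1"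
    then have "q = 1" using \<nu>.prob_le_1[of "{- c<..}"] by (simp add: q_def)
    then have "AE x in ?\<nu>. x \<in> {- c<..}"
      unfolding q_def by (intro \<nu>.AE_prob_1)
    moreover have "?\<nu> = distr (density lborel (normal_density 0 1)) borel (\<lambda>x. x - 2 * \<theta>)"
      by (simp add: increment_law_def)
    ultimately have "AE x in distr (density lborel (normal_density 0 1)) borel (\<lambda>x. x - 2 * \<theta>). x \<in> {- c<..}"
      by (simp only:)
    then have "AE x in density lborel (normal_density 0 1). - c < x - 2 * \<theta>"
      by (subst (asm) AE_distr_iff) auto
    then have "AE x in lborel. - c < x - 2 * \<theta>"
      by (subst (asm) AE_density) (auto simp: normal_density_pos)
    \<comment> \<open>An interval of length 1 that violates the bound; the Gaussian density is
      positive, so it would have to be Lebesgue null.\<close>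
    then have "AE x in lborel. x \<notin> {2 * \<theta> - c - 1..2 * \<theta> - c}"
      by eventually_elim auto
    then have "emeasure lborel {2 * \<theta> - c - 1..2 * \<theta> - c} = 0"
      by (subst (asm) AE_iff_measurable[where N = "{2 * \<theta> - c - 1..2 * \<theta> - c}"]) auto
    then show False by simp
  qed
  have null: "AE x in S. \<exists>m\<ge>J. x m \<le> - c" for J :: nat
  proof -
    define E where "E i = (if J \<le> i then {- c<..} else UNIV)" for i
    have E: "E i \<in> sets ?\<nu>" for i by (simp add: E_def sets_increment_law)
    have "measure ?\<nu> UNIV = 1" using \<nu>.prob_space by (simp add: increment_law_def)
    \<comment> \<open>The exponent counts the constrained indices from \<open>J\<close> to
      \<open>n\<close>; truncated subtraction makes it 0 for \<open>n < J\<close>.\<close>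
    then have prod: "(\<Prod>i\<le>n. measure ?\<nu> (E i)) = q ^ (Suc n - J)" for n
      by (induction n) (auto simp: E_def q_def Suc_diff_le)
    have "(\<lambda>n. q ^ n) \<longlonglongrightarrow> 0"
      using \<open>q < 1\<close> by (intro LIMSEQ_power_zero) (simp add: q_def)
    from LIMSEQ_Suc[OF this] have "(\<lambda>n. q ^ (Suc (n + J) - J)) \<longlonglongrightarrow> 0"
      by (simp add: Suc_diff_le)
    then have "(\<lambda>n. q ^ (Suc n - J)) \<longlonglongrightarrow> 0"
      by (rule LIMSEQ_offset)
    moreover have "(\<lambda>n. q ^ (Suc n - J)) \<longlonglongrightarrow> measure S (Pi UNIV E)"
      using measure_PiM_countable[of E, OF E] unfolding prod .
    ultimately have "measure S (Pi UNIV E) = 0" by (rule LIMSEQ_unique[symmetric])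
    then have "Pi UNIV E \<in> null_sets S"
      using infprod_in_sets[of E, OF E] by (intro null_setsI) (simp_all only: P.emeasure_eq_measure ennreal_0)
    from AE_not_in[OF this] show ?thesis
      by eventually_elim (auto simp: E_def Pi_iff not_less split: if_splits)
  qed
  then have "AE x in S. \<forall>J. \<exists>m\<ge>J. x m \<le> - c" by (simp add: AE_all_countable)
  then have "AE x in distr M real_seqs (\<lambda>\<omega>. increments (drifted \<theta> \<beta> \<omega>) 1). \<forall>J. \<exists>m\<ge>J. x m \<le> - c"
    by (simp only: distr_increments_drifted[OF B zero_less_one])
  then show ?thesis
    by (subst (asm) AE_distr_iff[OF measurable_increments_drifted[OF B]]) measurable
qed

lemma reflected_brownian_motionE:
  assumes "reflected_brownian_motion \<theta> c M Y" "0 < c"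
  obtains \<beta> where "standard_brownian_motion M \<beta>"
    and "AE \<omega> in M. two_sided_reflection c (drifted \<theta> \<beta> \<omega>) (\<lambda>t. Y t \<omega>) \<and>
      (\<forall>r\<in>{0..c}. \<forall>t\<ge>0. measure lborel {s \<in> {0..t}. Y s \<omega> = r} = 0)"
proof -
  obtain \<beta> where \<beta>: "standard_brownian_motion M \<beta>"
    and L: "AE \<omega> in M. \<exists>L. is_local_time c (\<lambda>t. Y t \<omega>) L \<and>
      (\<forall>t\<ge>0. Y t \<omega> = \<beta> t \<omega> - 2 * \<theta> * t + 1/2 * L 0 t - 1/2 * L c t)"
    and paths: "\<And>\<omega>. \<omega> \<in> space M \<Longrightarrow> (\<lambda>t. Y t \<omega>) \<in> cont_paths c"
    and start: "AE \<omega> in M. Y 0 \<omega> = 0"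
    using assms(1) unfolding reflected_brownian_motion_def by blast
  have "AE \<omega> in M. two_sided_reflection c (drifted \<theta> \<beta> \<omega>) (\<lambda>t. Y t \<omega>) \<and>
      (\<forall>r\<in>{0..c}. \<forall>t\<ge>0. measure lborel {s \<in> {0..t}. Y s \<omega> = r} = 0)"
    using L start AE_space
  proof eventually_elim
    case (elim \<omega>)
    then obtain L where L: "is_local_time c (\<lambda>t. Y t \<omega>) L"
      and eq: "\<And>t. 0 \<le> t \<Longrightarrow> Y t \<omega> = drifted \<theta> \<beta> \<omega> t + 1/2 * L 0 t - 1/2 * L c t"
      unfolding drifted_def by blast
    have "two_sided_reflection c (drifted \<theta> \<beta> \<omega>) (\<lambda>t. Y t \<omega>)"
      by (rule two_sided_reflection_local_time[OF L paths[OF elim(3)] assms(2) elim(2) eq])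
    moreover have "measure lborel {s \<in> {0..t}. Y s \<omega> = r} = 0" if "r \<in> {0..c}" "0 \<le> t" for r t
      by (rule local_time_level_null[OF L that(2,1)])
    ultimately show ?case by blast
  qed
  with \<beta> that show ?thesis by blast
qed

lemma measurable_reflected_walk_increments:
  assumes "standard_brownian_motion M \<beta>"
  shows "(\<lambda>\<omega>. reflected_walk c r (increments (drifted \<theta> \<beta> \<omega>) n) k) \<in> borel_measurable M"
    and "(\<lambda>\<omega>. reflected_walk c r (censor a b K r' (increments (drifted \<theta> \<beta> \<omega>) n)) k) \<in> borel_measurable M"
  using measurable_increments_drifted[OF assms]
  by (auto intro!: measurable_compose[OF _ measurable_reflected_walk])

text \<open>If the clock stayed below \<open>T\<close>, the kept walks would oscillate at every
  scale \<open>m\<close> for all fine meshes. They have the law of the walks built from the motion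
  on \<open>N\<close>, which approximate a continuous path and do not oscillate at a suitable
  scale.\<close>

lemma AE_time_below_unbounded:
  assumes levels: "0 < b" "b < a" and Y: "continuous_process M Y"
    and \<beta>: "standard_brownian_motion M \<beta>" and \<beta>': "standard_brownian_motion N \<beta>'"
    and X: "AE \<omega> in M. censored_path (\<lambda>t. Y t \<omega>) b a (drifted \<theta> \<beta> \<omega>)"
    and X': "AE \<omega> in N. two_sided_reflection b (drifted \<theta> \<beta>' \<omega>) (\<lambda>t. Y' t \<omega>)"
  shows "AE \<omega> in M. \<forall>T. \<exists>r\<ge>0. T < time_below b (\<lambda>t. Y t \<omega>) r"
proof -
  interpret M: prob_space M using \<beta> by (rule standard_brownian_motionD)
  interpret N: prob_space N using \<beta>' by (rule standard_brownian_motionD)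
  interpret continuous_process M Y by fact
  note [measurable] = measurable_time_below measurable_reflected_walk_increments[OF \<beta>]
    measurable_reflected_walk_increments[OF \<beta>']
  have "AE \<omega> in M. \<exists>k :: nat. real T < time_below b (\<lambda>t. Y t \<omega>) (real k)" for T :: nat
  proof -
    define B where "B = {\<omega> \<in> space M. \<forall>k :: nat. time_below b (\<lambda>t. Y t \<omega>) (real k) \<le> real T}"
    have B: "B \<in> sets M" unfolding B_def by measurable
    define G where "G m = {\<omega> \<in> space N. \<forall>\<^sub>F n in sequentially. \<not> oscillates (b / 2) T m (Suc n)
        (reflected_walk b 0 (increments (drifted \<theta> \<beta>' \<omega>) (Suc n)))}" for m
    have G: "G m \<in> sets N" for m
      unfolding G_def eventually_sequentially by measurable
    have le: "measure M B \<le> 1 - measure N (G m)" for m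
    proof -
      define E where "E n = {\<omega> \<in> space M. oscillates (b / 2) T m (Suc n)
        (reflected_walk b 0 (censor a b (Suc n * Suc n) 0 (increments (drifted \<theta> \<beta> \<omega>) (Suc n))))}" for n
      define F where "F n = {\<omega> \<in> space N. oscillates (b / 2) T m (Suc n)
        (reflected_walk b 0 (increments (drifted \<theta> \<beta>' \<omega>) (Suc n)))}" for n
      have "measure M B \<le> 1 - measure N {\<omega> \<in> space N. \<forall>\<^sub>F n in sequentially. \<omega> \<notin> F n}"
      proof (rule measure_eventually_le[OF M.prob_space_axioms N.prob_space_axioms B])
        show "E n \<in> sets M" "F n \<in> sets N" for n
          unfolding E_def F_def by measurable
        show "measure M (E n) = measure N (F n)" for n
        proof -
          let ?O = "{x \<in> space real_seqs. oscillates (b / 2) T m (Suc n) (reflected_walk b 0 x)}"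
          have O: "?O \<in> sets real_seqs" by measurable
          have "measure M (E n) = measure (distr M real_seqs
              (\<lambda>\<omega>. censor a b (Suc n * Suc n) 0 (increments (drifted \<theta> \<beta> \<omega>) (Suc n)))) ?O"
            using measurable_increments_drifted[OF \<beta>]
            by (subst measure_distr[OF _ O])
              (auto intro!: arg_cong[of _ _ "measure M"] simp: E_def space_PiM simp del: censor.simps)
          also have "\<dots> = measure (distr N real_seqs (\<lambda>\<omega>. increments (drifted \<theta> \<beta>' \<omega>) (Suc n))) ?O"
            by (simp only: distr_censored_increments[OF \<beta> \<beta>' zero_less_Suc])
          also have "\<dots> = measure N (F n)"
            using measurable_increments_drifted[OF \<beta>']
            by (subst measure_distr[OF _ O])
              (auto intro!: arg_cong[of _ _ "measure N"] simp: F_def space_PiM)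
          finally show ?thesis .
        qed
        show "AE \<omega> in M. \<omega> \<in> B \<longrightarrow> (\<forall>\<^sub>F n in sequentially. \<omega> \<in> E n)"
          using X AE_large_decrease[OF \<beta>, of \<theta> "a + 1"] AE_space
        proof eventually_elim
          case (elim \<omega>)
          interpret censored_path "\<lambda>t. Y t \<omega>" b a "drifted \<theta> \<beta> \<omega>" by (rule elim)
          have zeros: "\<exists>s\<ge>real J. Y s \<omega> = 0" for J :: nat
          proof -
            obtain m where "J \<le> m" "increments (drifted \<theta> \<beta> \<omega>) 1 m \<le> - (a + 1)" using elim(2) by blast
            with two_sided_reflection_zero[OF reflection this(2)] show ?thesis
              by (meson of_nat_le_iff order_trans)
          qed
          show ?case
          proof
            assume "\<omega> \<in> B"
            then have "\<forall>\<^sub>F n in sequentially. oscillates (b / 2) T m n (Z n)"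
              by (intro censored_walk_eventually_oscillates zeros) (auto simp: B_def)
            then have "\<forall>\<^sub>F n in sequentially. oscillates (b / 2) T m (Suc n) (Z (Suc n))"
              by (rule eventually_sequentially_Suc[THEN iffD2])
            then show "\<forall>\<^sub>F n in sequentially. \<omega> \<in> E n"
              using elim(3) by (simp only: E_def mem_Collect_eq simp_thms)
          qed
        qed
      qed
      also have "{\<omega> \<in> space N. \<forall>\<^sub>F n in sequentially. \<omega> \<notin> F n} = G m"
        unfolding F_def G_def by (auto elim: eventually_mono)
      finally show ?thesis .
    qed
    \<comment> \<open>Oscillation in a shorter window is also oscillation in a longer one, so
      refining the scale enlarges \<open>G\<close>.\<close>
    have "incseq G"
      unfolding G_def by (intro incseq_SucI) (auto elim!: eventually_mono dest: oscillates_mono[OF _ le_SucI[OF order_refl]])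
    then have "(\<lambda>m. measure N (G m)) \<longlonglongrightarrow> measure N (\<Union>m. G m)"
      using G by (intro N.finite_Lim_measure_incseq) auto
    moreover have "measure N (\<Union>m. G m) = 1"
    proof (subst N.prob_eq_1)
      show "(\<Union>m. G m) \<in> sets N" using G by auto
      show "AE \<omega> in N. \<omega> \<in> (\<Union>m. G m)"
        using X' AE_space
      proof eventually_elim
        case (elim \<omega>)
        obtain m where "\<forall>\<^sub>F n in sequentially. \<not> oscillates (b / 2) T m n
            (reflected_walk b 0 (increments (drifted \<theta> \<beta>' \<omega>) n))"
          using reflected_walk_not_oscillates[OF elim(1), of "b / 2" T] levels by auto
        then have "\<forall>\<^sub>F n in sequentially. \<not> oscillates (b / 2) T m (Suc n)
            (reflected_walk b 0 (increments (drifted \<theta> \<beta>' \<omega>) (Suc n)))"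
          by (subst eventually_sequentially_Suc[of "\<lambda>n. \<not> oscillates (b / 2) T m n
            (reflected_walk b 0 (increments (drifted \<theta> \<beta>' \<omega>) n))"])
        then show ?case using elim(2) by (auto simp: G_def)
      qed
    qed
    ultimately have "(\<lambda>m. 1 - measure N (G m)) \<longlonglongrightarrow> 1 - 1"
      by (intro tendsto_diff tendsto_const) simp
    then have "measure M B \<le> 0"
      using le by (intro LIMSEQ_le_const[of "\<lambda>m. 1 - measure N (G m)"]) auto
    then have "B \<in> null_sets M"
      using B by (auto simp: M.emeasure_eq_measure measure_le_0_iff)
    from AE_not_in[OF this] AE_space show ?thesis
      by eventually_elim (auto simp: B_def not_le)
  qed
  then have "AE \<omega> in M. \<forall>T :: nat. \<exists>k :: nat. real T < time_below b (\<lambda>t. Y t \<omega>) (real k)"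
    by (simp add: AE_all_countable)
  then show ?thesis
  proof eventually_elim
    case (elim \<omega>)
    show ?case
    proof
      fix T :: real
      obtain n :: nat where "T \<le> real n" using real_arch_simple by blast
      moreover obtain k :: nat where "real n < time_below b (\<lambda>t. Y t \<omega>) (real k)" using elim by blast
      ultimately show "\<exists>r\<ge>0. T < time_below b (\<lambda>t. Y t \<omega>) r"
        by (intro exI[of _ "real k"]) simp
    qed
  qed
qed

theorem lemma2p1:
  fixes \<theta> a b :: real
    and M :: "'v measure" and Ha :: "real \<Rightarrow> 'v \<Rightarrow> real"
    and N :: "'w measure" and Hb :: "real \<Rightarrow> 'w \<Rightarrow> real"
  assumes "a > b" and "b > 0"
    and "reflected_brownian_motion \<theta> a M Ha"
    and "reflected_brownian_motion \<theta> b N Hb"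
  shows "(AE \<omega> in M. path_proj b (\<lambda>s. Ha s \<omega>) \<in> cont_paths b) \<and>
    same_law M (\<lambda>t \<omega>. path_proj b (\<lambda>s. Ha s \<omega>) t) N Hb"
proof -
  have "0 < a" using assms(1,2) by simp
  obtain \<beta> where \<beta>: "standard_brownian_motion M \<beta>"
    and Ha: "AE \<omega> in M. two_sided_reflection a (drifted \<theta> \<beta> \<omega>) (\<lambda>t. Ha t \<omega>) \<and>
      (\<forall>r\<in>{0..a}. \<forall>t\<ge>0. measure lborel {s \<in> {0..t}. Ha s \<omega> = r} = 0)"
    by (rule reflected_brownian_motionE[OF assms(3) \<open>0 < a\<close>])
  obtain \<beta>' where \<beta>': "standard_brownian_motion N \<beta>'"
    and Hb: "AE \<omega> in N. two_sided_reflection b (drifted \<theta> \<beta>' \<omega>) (\<lambda>t. Hb t \<omega>) \<and>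
      (\<forall>r\<in>{0..b}. \<forall>t\<ge>0. measure lborel {s \<in> {0..t}. Hb s \<omega> = r} = 0)"
    by (rule reflected_brownian_motionE[OF assms(4) \<open>0 < b\<close>])
  have paths: "(\<lambda>t. Ha t \<omega>) \<in> cont_paths a" if "\<omega> \<in> space M" for \<omega>
    using assms(3) that by (simp add: reflected_brownian_motion_def)
  have process: "continuous_process M Ha"
    using assms(3) by unfold_locales (auto simp: reflected_brownian_motion_def cont_paths_def)
  have X: "AE \<omega> in M. censored_path (\<lambda>t. Ha t \<omega>) b a (drifted \<theta> \<beta> \<omega>)"
    using Ha
  proof eventually_elim
    case (elim \<omega>)
    then show ?case
      using assms(1,2) by unfold_locales (auto simp: two_sided_reflection_def cont_paths_def)
  qed
  \<comment> \<open>\<open>Hb\<close> already enters here, as the continuous process against which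
    the kept walks are compared.\<close>
  have unbounded: "AE \<omega> in M. \<forall>T. \<exists>r\<ge>0. T < time_below b (\<lambda>t. Ha t \<omega>) r"
    using Hb by (intro AE_time_below_unbounded[OF assms(2,1) process \<beta> \<beta>' X]) (auto elim: eventually_mono)
  have "AE \<omega> in M. path_proj b (\<lambda>s. Ha s \<omega>) \<in> cont_paths b"
    using unbounded AE_space
  proof eventually_elim
    case (elim \<omega>)
    interpret clocked_path "\<lambda>t. Ha t \<omega>" b
      by unfold_locales (use paths[OF elim(2)] in \<open>simp add: cont_paths_def\<close>)
    show ?case
      by (rule path_proj_in_cont_paths) (use elim paths[OF elim(2)] in \<open>auto simp: cont_paths_def\<close>)
  qed
  moreover have "same_law M (\<lambda>t \<omega>. path_proj b (\<lambda>s. Ha s \<omega>) t) N Hb"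
  \<comment> \<open>The approximants are the kept walk and the walk in \<open>{0..b}\<close>, read
    at step \<open>\<lfloor>real (Suc n) * t\<rfloor>\<close>; \<open>Suc n\<close> keeps the mesh
    number positive.\<close>
  proof (rule same_law_limit)
    show "prob_space M" "prob_space N" using \<beta> \<beta>' by (auto dest: standard_brownian_motionD)
    show "same_law M (\<lambda>t \<omega>. reflected_walk b 0
          (censor a b (Suc n * Suc n) 0 (increments (drifted \<theta> \<beta> \<omega>) (Suc n))) (nat \<lfloor>real (Suc n) * t\<rfloor>))
        N (\<lambda>t \<omega>. reflected_walk b 0 (increments (drifted \<theta> \<beta>' \<omega>) (Suc n)) (nat \<lfloor>real (Suc n) * t\<rfloor>))" for n
      by (intro same_law_compose[where g = "\<lambda>t x. reflected_walk b 0 x (nat \<lfloor>real (Suc n) * t\<rfloor>)",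
            OF _ _ distr_censored_increments[OF \<beta> \<beta>' zero_less_Suc]] measurable_reflected_walk
          measurable_censor borel_measurable_const measurable_increments_drifted[OF \<beta>]
          measurable_increments_drifted[OF \<beta>'])
    show "(\<lambda>\<omega>. path_proj b (\<lambda>s. Ha s \<omega>) t) \<in> borel_measurable M" for t
      by (rule continuous_process.measurable_path_proj[OF process])
    show "Hb t \<in> borel_measurable N" if "0 \<le> t" for t
      using assms(4) that by (simp add: reflected_brownian_motion_def)
    show "AE \<omega> in M. (\<lambda>n. reflected_walk b 0 (censor a b (Suc n * Suc n) 0 (increments (drifted \<theta> \<beta> \<omega>) (Suc n)))
        (nat \<lfloor>real (Suc n) * t\<rfloor>)) \<longlonglongrightarrow> path_proj b (\<lambda>s. Ha s \<omega>) t" if "0 \<le> t" for t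
      using X unbounded
    proof eventually_elim
      case (elim \<omega>)
      interpret censored_path "\<lambda>t. Ha t \<omega>" b a "drifted \<theta> \<beta> \<omega>" by (rule elim)
      show ?case
        by (rule LIMSEQ_Suc[OF censored_walk_tendsto[OF that]]) (use elim(2) in blast)
    qed
    show "AE \<omega> in N. (\<lambda>n. reflected_walk b 0 (increments (drifted \<theta> \<beta>' \<omega>) (Suc n))
        (nat \<lfloor>real (Suc n) * t\<rfloor>)) \<longlonglongrightarrow> Hb t \<omega>" if "0 \<le> t" for t
      using Hb
    proof eventually_elim
      case (elim \<omega>)
      then show ?case
        using reflected_walk_tendsto[OF _ assms(2) that, of "drifted \<theta> \<beta>' \<omega>" "\<lambda>t. Hb t \<omega>"]
        by (intro LIMSEQ_Suc) blast
    qed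
  qed
  ultimately show ?thesis ..
qed

end
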